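(* Let $\mathcal{M}$ be a rank $7$ Lawrence oriented matroid on $11$ elements with $\mathcal{M}\notin[C_7(11)]$. Then $f_{\mathcal{M}}(7,11,2)\le c_7(11,2)=112$, and there are exactly $255$ reorientation classes $[\mathcal{M}]$ of such oriented matroids (rank $7$ Lawrence oriented matroids on the ground set $\{1,\dots,11\}$, not in $[C_7(11)]$) with $f_{\mathcal{M}}(7,11,2)=c_7(11,2)$.
   Context: An oriented matroid $\mathcal{M}=(E,\mathcal{C})$ is given by its finite ground set $E$ and its set $\mathcal{C}\subseteq\{+,-,0\}^E$ of signed circuits; for a sign vector $X$, $X^+$ and $X^-$ are the sets of positive and negative elements and $\underline{X}=X^+\cup X^-$ is the support. All oriented matroids are simple (all circuits have size at least $3$). For $R\subseteq E$, the reorientation ${}_{-R}\mathcal{M}$ is obtained from $\mathcal{M}$ by reversing the sign of $X_e$ for every $e\in R$ and every circuit $X$. The reorientation class $[\mathcal{M}]$ is the set of all ${}_{-R}\mathcal{M}$, $R\subseteq E$ (labelled ground set; no relabelling of elements is allowed). For an integer $k\ge 0$, $\mathcal{M}$ is $k$-neighborly if $|X^+|>k$ and $|X^-|>k$ for every circuit $X$. For an oriented matroid $\mathcal{M}$ of rank $r$ on $n$ elements, $f_{\mathcal{M}}(r,n,k)$ denotes the number of subsets $R\subseteq E$ such that ${}_{-R}\mathcal{M}$ is $k$-neighborly; it depends only on $[\mathcal{M}]$. The alternating oriented matroid $C_r(n)$ is the uniform oriented matroid of rank $r$ on $[n]=\{1,\dots,n\}$ in which every circuit $X$ with support $i_1<\dots<i_{r+1}$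 satisfies $X_{i_j}=-X_{i_{j+1}}$ for $1\le j\le r$. Put $c_r(n,k)=f_{C_r(n)}(r,n,k)$. Lawrence oriented matroid (LOM): for an $r\times n$ matrix $A=(a_{i,j})$ with entries in $\{+1,-1\}$, $r\le n$, $\mathcal{M}_A$ is the uniform oriented matroid of rank $r$ on $[n]$ with chirotope $\chi(j_1,\dots,j_r)=\prod_{i=1}^r a_{i,j_i}$ for $j_1<\dots<j_r$. Equivalently, its circuits are the sign vectors $X$ with support $j_1<\dots<j_{r+1}$ such that $X_{j_{i+1}}=-X_{j_i}a_{i,j_i}a_{i,j_{i+1}}$ for $1\le i\le r$. A rank $r$ LOM on $n$ elements is an oriented matroid of the form $\mathcal{M}_A$ for such a matrix $A$. *)

theory Defs
  imports Complex_Main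
begin

section \<open>Sign vectors and oriented matroids\<close>

text \<open>A sign vector on \<open>E\<close> is an integer function with values in \<open>{-1, 0, 1}\<close> that vanishes
  off \<open>E\<close>.\<close>

type_synonym 'a sign_vector = "'a \<Rightarrow> int"

definition positive :: "'a sign_vector \<Rightarrow> 'a set" where
  "positive X = {e. X e > 0}"

definition negative :: "'a sign_vector \<Rightarrow> 'a set" where
  "negative X = {e. X e < 0}"

definition support :: "'a sign_vector \<Rightarrow> 'a set" where
  "support X = positive X \<union> negative X"

definition sign_vectors :: "'a set \<Rightarrow> 'a sign_vector set" where
  "sign_vectors E = {X. (\<forall>e. X e \<in> {-1, 0, 1}) \<and> support X \<subseteq> E}"

record 'a signed_system =
  ground :: "'a set"
  circuits :: "'a sign_vector set"

text \<open>Weak circuit elimination is the standard form of the last axiom.\<close>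

definition oriented_matroid :: "'a signed_system \<Rightarrow> bool" where
  "oriented_matroid M \<longleftrightarrow>
     finite (ground M) \<and>
     circuits M \<subseteq> sign_vectors (ground M) \<and>
     (\<forall>X\<in>circuits M. support X \<noteq> {}) \<and>
     (\<forall>X\<in>circuits M. - X \<in> circuits M) \<and>
     (\<forall>X\<in>circuits M. \<forall>Y\<in>circuits M. support X \<subseteq> support Y \<longrightarrow> X = Y \<or> X = - Y) \<and>
     (\<forall>X\<in>circuits M. \<forall>Y\<in>circuits M. \<forall>e\<in>positive X \<inter> negative Y. X \<noteq> - Y \<longrightarrow>
        (\<exists>Z\<in>circuits M. positive Z \<subseteq> (positive X \<union> positive Y) - {e} \<and>
                        negative Z \<subseteq> (negative X \<union> negative Y) - {e}))"

definition simple_om :: "'a signed_system \<Rightarrow> bool" where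
  "simple_om M \<longleftrightarrow> oriented_matroid M \<and> (\<forall>X\<in>circuits M. card (support X) \<ge> 3)"

definition uniform_of_rank :: "nat \<Rightarrow> 'a signed_system \<Rightarrow> bool" where
  "uniform_of_rank r M \<longleftrightarrow>
     r \<le> card (ground M) \<and>
     support ` circuits M = {S. S \<subseteq> ground M \<and> card S = r + 1}"

definition reorient :: "'a set \<Rightarrow> 'a signed_system \<Rightarrow> 'a signed_system" where
  "reorient R M =
     \<lparr>ground = ground M,
      circuits = (\<lambda>X e. if e \<in> R then - X e else X e) ` circuits M\<rparr>"

definition reorientation_class :: "'a signed_system \<Rightarrow> 'a signed_system set" where
  "reorientation_class M = {reorient R M |R. R \<subseteq> ground M}"

definition neighborly :: "nat \<Rightarrow> 'a signed_system \<Rightarrow> bool" where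
  "neighborly k M \<longleftrightarrow> (\<forall>X\<in>circuits M. card (positive X) > k \<and> card (negative X) > k)"

text \<open>The rank and the number of elements, which appear as arguments of \<open>f\<close> on paper, are
  determined by \<open>M\<close>.\<close>

definition f_num :: "'a signed_system \<Rightarrow> nat \<Rightarrow> nat" where
  "f_num M k = card {R. R \<subseteq> ground M \<and> neighborly k (reorient R M)}"


section \<open>Alternating and Lawrence oriented matroids\<close>

definition alternating_om :: "nat \<Rightarrow> nat \<Rightarrow> nat signed_system" where
  "alternating_om r n =
     \<lparr>ground = {1..n},
      circuits = {X \<in> sign_vectors {1..n}. card (support X) = r + 1 \<and>
        (let js = sorted_list_of_set (support X) in \<forall>i<r. X (js ! i) = - X (js ! Suc i))}\<rparr>"

definition c_num :: "nat \<Rightarrow> nat \<Rightarrow> nat \<Rightarrow> nat" where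
  "c_num r n k = f_num (alternating_om r n) k"

text \<open>The uniform oriented matroid of rank \<open>r\<close> on \<open>{1..n}\<close> with a given nowhere-zero chirotope
  \<open>\<chi>\<close>, which, being alternating, is given by its values on increasing lists of length \<open>r\<close>.
  By the usual correspondence between chirotopes and circuits, the two opposite circuits
  supported on \<open>j\<^sub>0 < \<dots> < j\<^sub>r\<close> are
  \<open>X j\<^sub>k = \<plusminus> (-1)^k * \<chi>(j\<^sub>0, \<dots>, j\<^sub>k\<^sub>-\<^sub>1, j\<^sub>k\<^sub>+\<^sub>1, \<dots>, j\<^sub>r)\<close>.\<close>

definition uniform_of_chirotope :: "nat \<Rightarrow> nat \<Rightarrow> (nat list \<Rightarrow> int) \<Rightarrow> nat signed_system" where
  "uniform_of_chirotope r n \<chi> =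
     \<lparr>ground = {1..n},
      circuits = {X \<in> sign_vectors {1..n}. card (support X) = r + 1 \<and>
        (let js = sorted_list_of_set (support X) in
           \<exists>s\<in>{1, -1}. \<forall>k\<le>r. X (js ! k) = s * (-1) ^ k * \<chi> (take k js @ drop (Suc k) js))}\<rparr>"

text \<open>Rows and columns of \<open>A\<close> are numbered from 1, positions in a list from 0.\<close>

definition lawrence_chirotope :: "nat \<Rightarrow> (nat \<Rightarrow> nat \<Rightarrow> int) \<Rightarrow> nat list \<Rightarrow> int" where
  "lawrence_chirotope r A js = (\<Prod>i=1..r. A i (js ! (i - 1)))"

definition lawrence_om :: "nat \<Rightarrow> nat \<Rightarrow> (nat \<Rightarrow> nat \<Rightarrow> int) \<Rightarrow> nat signed_system" where
  "lawrence_om r n A = uniform_of_chirotope r n (lawrence_chirotope r A)"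

definition sign_matrix :: "nat \<Rightarrow> nat \<Rightarrow> (nat \<Rightarrow> nat \<Rightarrow> int) \<Rightarrow> bool" where
  "sign_matrix r n A \<longleftrightarrow> (\<forall>i\<in>{1..r}. \<forall>j\<in>{1..n}. A i j \<in> {1, -1})"

definition is_lawrence_om :: "nat \<Rightarrow> nat \<Rightarrow> nat signed_system \<Rightarrow> bool" where
  "is_lawrence_om r n M \<longleftrightarrow> r \<le> n \<and> (\<exists>A. sign_matrix r n A \<and> M = lawrence_om r n A)"


section \<open>Consistency of the definitions\<close>

text \<open>The circuits of a Lawrence oriented matroid satisfy the sign recursion along consecutive
  elements of their support. The circuit axioms are then obtained from the realization of
  \<open>lawrence_om r n A\<close> by the real matrix with entries \<open>A i j * B ^ (i * j)\<close>, \<open>B\<close> large.\<close>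

definition chain :: "nat \<Rightarrow> (nat \<Rightarrow> nat \<Rightarrow> int) \<Rightarrow> nat sign_vector \<Rightarrow> nat list \<Rightarrow> bool" where
  "chain r A X js \<longleftrightarrow>
     (\<forall>i<r. X (js ! Suc i) = - X (js ! i) * A (Suc i) (js ! i) * A (Suc i) (js ! Suc i))"

lemma support_iff: "e \<in> support X \<longleftrightarrow> X e \<noteq> 0"
  by (auto simp: support_def positive_def negative_def)

lemma sign_mult_self: "(a::int) \<in> {1, -1} \<Longrightarrow> a * a = 1"
  by auto

lemma lawrence_chirotope_delete:
  assumes "length js = r + 1" "k \<le> r"
  shows "lawrence_chirotope r A (take k js @ drop (Suc k) js) =
         (\<Prod>i<r. A (Suc i) (js ! (if i < k then i else Suc i)))"
proof -
  have "lawrence_chirotope r A (take k js @ drop (Suc k) js) =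
        (\<Prod>i<r. A (Suc i) ((take k js @ drop (Suc k) js) ! i))"
    unfolding lawrence_chirotope_def
    by (rule prod.reindex_bij_witness[of _ Suc "\<lambda>i. i - 1"]) auto
  also have "\<dots> = (\<Prod>i<r. A (Suc i) (js ! (if i < k then i else Suc i)))"
    using assms by (intro prod.cong) (auto simp: nth_append)
  finally show ?thesis .
qed

lemma lawrence_chirotope_step:
  assumes "length js = r + 1" "k < r" "set js \<subseteq> {1..n}" "sign_matrix r n A"
  shows "lawrence_chirotope r A (take (Suc k) js @ drop (Suc (Suc k)) js) =
         lawrence_chirotope r A (take k js @ drop (Suc k) js) *
           A (Suc k) (js ! k) * A (Suc k) (js ! Suc k)"
proof -
  have mem: "js ! i \<in> {1..n}" if "i \<le> r" for i
    using that assms(1,3) nth_mem[of i js] by (metis Suc_eq_plus1 less_Suc_eq_le subsetD)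
  have sq: "A (Suc k) (js ! Suc k) * A (Suc k) (js ! Suc k) = 1"
    using assms(2,4) mem[of "Suc k"] by (intro sign_mult_self) (auto simp: sign_matrix_def)
  have *: "(\<Prod>i<r. A (Suc i) (js ! (if i < l then i else Suc i))) =
        A (Suc k) (js ! (if k < l then k else Suc k)) *
        (\<Prod>i\<in>{..<r}-{k}. A (Suc i) (js ! (if i < l then i else Suc i)))" for l
    using assms(2) by (subst prod.remove[of _ k]) auto
  have e: "(\<Prod>i\<in>{..<r}-{k}. A (Suc i) (js ! (if i < Suc k then i else Suc i))) =
        (\<Prod>i\<in>{..<r}-{k}. A (Suc i) (js ! (if i < k then i else Suc i)))"
    by (intro prod.cong) auto
  show ?thesis
    using assms(1,2) sq e by (simp add: lawrence_chirotope_delete *[of k] *[of "Suc k"] algebra_simps)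
qed

lemma chirotope_circuit_iff_chain:
  assumes js: "length js = r + 1" "set js \<subseteq> {1..n}" and A: "sign_matrix r n A"
    and X: "X (js ! 0) \<in> {1, -1}"
  shows "(\<exists>s\<in>{1, -1}. \<forall>k\<le>r. X (js ! k) =
            s * (-1) ^ k * lawrence_chirotope r A (take k js @ drop (Suc k) js)) \<longleftrightarrow> chain r A X js"
    (is "?L \<longleftrightarrow> ?R")
proof
  assume ?L
  then obtain s where s: "\<And>k. k \<le> r \<Longrightarrow> X (js ! k) =
      s * (-1) ^ k * lawrence_chirotope r A (take k js @ drop (Suc k) js)" by blast
  show ?R unfolding chain_def
  proof (intro allI impI)
    fix i assume "i < r"
    then show "X (js ! Suc i) = - X (js ! i) * A (Suc i) (js ! i) * A (Suc i) (js ! Suc i)"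
      using s[of i] s[of "Suc i"] lawrence_chirotope_step[OF js(1) _ js(2) A, of i]
      by (simp add: mult.assoc)
  qed
next
  assume R: ?R
  define c where "c = lawrence_chirotope r A (take 0 js @ drop (Suc 0) js)"
  have mem: "js ! i \<in> {1..n}" if "i \<le> r" for i
    using that js nth_mem[of i js] by (metis Suc_eq_plus1 less_Suc_eq_le subsetD)
  have "A (Suc i) (js ! Suc i) \<in> {1, -1}" if "i < r" for i
    using that mem[of "Suc i"] A by (auto simp: sign_matrix_def)
  then have "(\<Prod>i<m. A (Suc i) (js ! Suc i)) \<in> {1, -1}" if "m \<le> r" for m
    using that
  proof (induction m)
    case (Suc m)
    then have "(\<Prod>i<m. A (Suc i) (js ! Suc i)) \<in> {1, -1}" "A (Suc m) (js ! Suc m) \<in> {1, -1}"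
      by auto
    then show ?case by auto
  qed simp
  then have c: "c \<in> {1, -1}"
    using js(1) by (simp add: c_def lawrence_chirotope_delete[of js r 0, simplified])
  have "X (js ! k) = (X (js ! 0) * c) * (-1) ^ k *
          lawrence_chirotope r A (take k js @ drop (Suc k) js)" if "k \<le> r" for k
    using that
  proof (induction k)
    case 0
    show ?case using c X by (auto simp: c_def)
  next
    case (Suc k)
    then have "X (js ! Suc k) = - X (js ! k) * A (Suc k) (js ! k) * A (Suc k) (js ! Suc k)"
      using R by (simp add: chain_def)
    then show ?case
      using Suc lawrence_chirotope_step[OF js(1) _ js(2) A, of k] by (simp add: mult.assoc)
  qed
  moreover have "X (js ! 0) * c \<in> {1, -1}" using c X by auto
  ultimately show ?L by blast
qed

lemma lawrence_circuits:
  assumes A: "sign_matrix r n A"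
  shows "X \<in> circuits (lawrence_om r n A) \<longleftrightarrow>
     X \<in> sign_vectors {1..n} \<and> card (support X) = r + 1 \<and>
     chain r A X (sorted_list_of_set (support X))"
proof (cases "X \<in> sign_vectors {1..n} \<and> card (support X) = r + 1")
  case True
  let ?js = "sorted_list_of_set (support X)"
  from True have "finite (support X)" using card.infinite by fastforce
  then have set: "set ?js = support X" and len: "length ?js = r + 1" using True by auto
  have "?js ! 0 \<in> support X" using set len by (metis nth_mem add_gr_0 zero_less_one)
  then have "X (?js ! 0) \<in> {1, -1}"
    using True support_iff by (fastforce simp: sign_vectors_def)
  moreover have "set ?js \<subseteq> {1..n}" using True set by (simp add: sign_vectors_def)
  ultimately show ?thesis
    using True chirotope_circuit_iff_chain[OF len _ A, of X]
    by (simp add: lawrence_om_def uniform_of_chirotope_def Let_def)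
qed (auto simp: lawrence_om_def uniform_of_chirotope_def)

lemma ground_lawrence [simp]: "ground (lawrence_om r n A) = {1..n}"
  by (simp add: lawrence_om_def uniform_of_chirotope_def)

lemma alternating_om_eq_lawrence: "alternating_om r n = lawrence_om r n (\<lambda>_ _. 1)"
proof -
  have "sign_matrix r n (\<lambda>_ _. 1)" by (simp add: sign_matrix_def)
  then have "circuits (alternating_om r n) = circuits (lawrence_om r n (\<lambda>_ _. 1))"
    using lawrence_circuits[of r n "\<lambda>_ _. 1"]
    by (auto simp: alternating_om_def Let_def chain_def)
  moreover have "ground (alternating_om r n) = ground (lawrence_om r n (\<lambda>_ _. 1))"
    by (simp add: alternating_om_def)
  ultimately show ?thesis by simp
qed

lemma circuit_of_sequence:
  assumes A: "sign_matrix r n A"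
    and g: "\<And>i. i < r \<Longrightarrow> g i < g (Suc i)" "\<And>i. i \<le> r \<Longrightarrow> g i \<in> {1..n}"
    and T: "\<And>i. i \<le> r \<Longrightarrow> T (g i) \<in> {1, -1 :: int}"
    and step: "\<And>i. i < r \<Longrightarrow> T (g (Suc i)) = - T (g i) * A (Suc i) (g i) * A (Suc i) (g (Suc i))"
  shows "(\<lambda>e. if e \<in> g ` {..r} then T e else 0) \<in> circuits (lawrence_om r n A)"
proof -
  let ?Z = "\<lambda>e. if e \<in> g ` {..r} then T e else 0"
  have mono: "g i < g j" if "i < j" "j \<le> r" for i j
    using that
  proof (induction j)
    case (Suc j)
    then show ?case using g(1)[of j] by (cases "i = j") auto
  qed simp
  have "T (g i) \<noteq> 0" if "i \<le> r" for i using T[OF that] by auto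
  then have supp: "support ?Z = g ` {..r}" by (auto simp: support_iff split: if_splits)
  have inj: "inj_on g {..r}"
    by (rule inj_onI) (metis atMost_iff linorder_neqE_nat mono less_irrefl)
  have "sorted_wrt (<) (map g [0..<Suc r])"
    unfolding sorted_wrt_iff_nth_less using mono by (auto simp del: upt_Suc)
  moreover have "set (map g [0..<Suc r]) = g ` {..r}"
    by (simp add: atLeast0LessThan lessThan_Suc_atMost del: upt_Suc)
  ultimately have "map g [0..<Suc r] = sorted_list_of_set (g ` {..r})"
    by (metis sorted_list_of_set.idem_if_sorted_distinct strict_sorted_iff)
  then have js: "sorted_list_of_set (support ?Z) = map g [0..<Suc r]" using supp by simp
  have "chain r A ?Z (map g [0..<Suc r])"
    unfolding chain_def using step by (auto simp del: upt_Suc)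
  then show ?thesis
    unfolding lawrence_circuits[OF A] js
    using supp inj g(2) T by (auto simp: sign_vectors_def card_image)
qed

text \<open>Scanning the ground set from left to right and moving to the next row at the first sign
  change finds a circuit conformal to \<open>T\<close> as soon as there is a sign change in every row.\<close>

lemma conformal_circuit_of_sign_changes:
  assumes A: "sign_matrix r n A" and "r \<ge> 1"
    and T: "\<And>j. T j \<in> {-1, 0, 1 :: int}"
    and lo: "\<And>i. i < r \<Longrightarrow> lo i \<in> {1..n} \<and> T (lo i) \<noteq> 0"
    and hi: "\<And>i. i < r \<Longrightarrow> hi i \<in> {1..n} \<and> T (hi i) \<noteq> 0"
    and lohi: "\<And>i. i < r \<Longrightarrow> lo i < hi i"
    and hilo: "\<And>i. Suc i < r \<Longrightarrow> hi i \<le> lo (Suc i)"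
    and opp: "\<And>i. i < r \<Longrightarrow> T (hi i) * A (Suc i) (hi i) = - (T (lo i) * A (Suc i) (lo i))"
  shows "\<exists>Z\<in>circuits (lawrence_om r n A). \<forall>e. Z e \<noteq> 0 \<longrightarrow> Z e = T e"
proof -
  define U where "U = {j\<in>{1..n}. T j \<noteq> 0}"
  have TU: "T j \<in> {1, -1}" if "j \<in> U" for j
    using T[of j] that by (auto simp: U_def)
  have AU: "A (Suc i) j \<in> {1, -1}" if "j \<in> U" "i < r" for i j
    using A that by (auto simp: sign_matrix_def U_def)
  have "\<exists>g. (\<forall>i\<le>m. g i \<in> U) \<and> (m < r \<longrightarrow> g m \<le> lo m) \<and>
     (\<forall>i<m. g i < g (Suc i) \<and> T (g (Suc i)) * A (Suc i) (g (Suc i)) = - (T (g i) * A (Suc i) (g i)))"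
    if "m \<le> r" for m
    using that
  proof (induction m)
    case 0
    show ?case by (rule exI[of _ "\<lambda>_. lo 0"]) (use lo[of 0] \<open>r \<ge> 1\<close> in \<open>auto simp: U_def\<close>)
  next
    case (Suc m)
    then obtain g where g: "\<And>i. i \<le> m \<Longrightarrow> g i \<in> U" "g m \<le> lo m"
       "\<And>i. i < m \<Longrightarrow> g i < g (Suc i) \<and> T (g (Suc i)) * A (Suc i) (g (Suc i)) = - (T (g i) * A (Suc i) (g i))"
      by auto
    have m: "m < r" using Suc by simp
    have U: "lo m \<in> U" "hi m \<in> U" "g m \<in> U" using lo[OF m] hi[OF m] g(1) by (auto simp: U_def)
    have val: "T j * A (Suc m) j \<in> {1, -1}" if "j \<in> U" for j
      using TU[OF that] AU[OF that m] by auto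
    obtain j where j: "j \<in> U" "g m < j" "j \<le> hi m"
      "T j * A (Suc m) j = - (T (g m) * A (Suc m) (g m))"
    proof (cases "T (lo m) * A (Suc m) (lo m) = T (g m) * A (Suc m) (g m)")
      case True
      then show ?thesis using that[of "hi m"] U g(2) lohi[OF m] opp[OF m] by simp
    next
      case False
      then have "T (lo m) * A (Suc m) (lo m) = - (T (g m) * A (Suc m) (g m))"
        using val[OF U(1)] val[OF U(3)] by auto
      moreover have "g m \<noteq> lo m" using False by auto
      ultimately show ?thesis using that[of "lo m"] U g(2) lohi[OF m] by simp
    qed
    have "Suc m < r \<longrightarrow> j \<le> lo (Suc m)" using j(3) hilo[of m] by auto
    then show ?case
      using g j by (intro exI[of _ "g(Suc m := j)"]) (auto simp: less_Suc_eq)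
  qed
  from this[OF order_refl] obtain g where g: "\<And>i. i \<le> r \<Longrightarrow> g i \<in> U"
     "\<And>i. i < r \<Longrightarrow> g i < g (Suc i)"
     "\<And>i. i < r \<Longrightarrow> T (g (Suc i)) * A (Suc i) (g (Suc i)) = - (T (g i) * A (Suc i) (g i))"
    by auto
  have "T (g (Suc i)) = - T (g i) * A (Suc i) (g i) * A (Suc i) (g (Suc i))" if "i < r" for i
    using g(3)[OF that] AU[of "g (Suc i)" i] g(1)[of "Suc i"] that by auto
  then have "(\<lambda>e. if e \<in> g ` {..r} then T e else 0) \<in> circuits (lawrence_om r n A)"
    using g TU by (intro circuit_of_sequence[OF A]) (auto simp: U_def)
  then show ?thesis by (rule bexI[rotated]) simp
qed

definition lawrence_kernel :: "nat \<Rightarrow> nat \<Rightarrow> (nat \<Rightarrow> nat \<Rightarrow> int) \<Rightarrow> (nat \<Rightarrow> real) set" where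
  "lawrence_kernel r n A = {x. (\<forall>j. x j \<noteq> 0 \<longrightarrow> j \<in> {1..n}) \<and>
     (\<forall>i\<in>{1..r}. (\<Sum>j=1..n. of_int (A i j) * real (n\<^sup>2 + 1) ^ (i * j) * x j) = 0)}"

lemma exists_opposite_large_term:
  fixes t :: "nat \<Rightarrow> real"
  assumes sum0: "(\<Sum>j=1..n. t j) = 0" and p: "p \<in> {1..n}" "t p \<noteq> 0"
    and max: "\<And>q. q \<in> {1..n} \<Longrightarrow> \<bar>t q\<bar> \<le> \<bar>t p\<bar>"
  obtains q where "q \<in> {1..n}" "t q * t p < 0" "\<bar>t p\<bar> \<le> real n * \<bar>t q\<bar>"
proof (rule ccontr)
  note large = that
  assume "\<not> thesis"
  then have neg: "\<bar>t p\<bar> > real n * \<bar>t q\<bar>" if "q \<in> {1..n}" "t q * t p < 0" for q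
    using that large[of q] by force
  define s where "s = sgn (t p)"
  have s: "s * t p = \<bar>t p\<bar>" "\<bar>s\<bar> = 1" using p(2) by (auto simp: s_def sgn_if)
  have n: "n > 0" using p(1) by auto
  have *: "s * t q > - (\<bar>t p\<bar> / real n)" if "q \<in> {1..n}" for q
  proof (cases "t q * t p < 0")
    case True
    then have "\<bar>t q\<bar> < \<bar>t p\<bar> / real n"
      using neg[OF that] n by (simp add: field_simps)
    moreover have "\<bar>s * t q\<bar> = \<bar>t q\<bar>" using s(2) by (simp add: abs_mult)
    ultimately show ?thesis by linarith
  next
    case False
    then have "s * t q \<ge> 0"
      by (auto simp: s_def sgn_if mult_less_0_iff not_less zero_le_mult_iff)
    moreover have "\<bar>t p\<bar> / real n > 0" using n p(2) by simp
    ultimately show ?thesis by linarith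
  qed
  have "0 = s * (\<Sum>j=1..n. t j)" using sum0 by simp
  also have "\<dots> = s * t p + (\<Sum>j\<in>{1..n}-{p}. s * t j)"
    using p(1) by (subst sum.remove[of _ p]) (auto simp: sum_distrib_left distrib_left)
  also have "\<dots> \<ge> \<bar>t p\<bar> + (\<Sum>j\<in>{1..n}-{p}. - (\<bar>t p\<bar> / real n))"
    using s * by (intro add_mono sum_mono) (auto intro: less_imp_le)
  also have "(\<Sum>j\<in>{1..n}-{p}. - (\<bar>t p\<bar> / real n)) = - (real (n - 1) * (\<bar>t p\<bar> / real n))"
    using p(1) by simp
  finally have "\<bar>t p\<bar> \<le> real (n - 1) * (\<bar>t p\<bar> / real n)" by simp
  also have "\<dots> < real n * (\<bar>t p\<bar> / real n)"
    using n p(2) by (intro mult_strict_right_mono) auto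
  finally show False using n by simp
qed

lemma kernel_conformal_circuit:
  assumes A: "sign_matrix r n A" and r: "r \<ge> 1"
    and x: "x \<in> lawrence_kernel r n A" and x0: "x e0 \<noteq> 0"
  shows "\<exists>Z\<in>circuits (lawrence_om r n A). \<forall>e. Z e \<noteq> 0 \<longrightarrow> of_int (Z e) = sgn (x e)"
proof -
  define B where "B = real (n\<^sup>2 + 1)"
  define t where "t i j = of_int (A i j) * B ^ (i * j) * x j" for i j
  define near where "near i k \<longleftrightarrow> k \<in> {1..n} \<and> x k \<noteq> 0 \<and>
      (\<forall>q\<in>{1..n}. \<bar>t i q\<bar> \<le> real n * \<bar>t i k\<bar>)" for i k
  have B: "B \<ge> 1" "B > (real n)\<^sup>2" by (simp_all add: B_def)
  have abs_A: "\<bar>real_of_int (A i j)\<bar> = 1" if "i \<in> {1..r}" "j \<in> {1..n}" for i j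
  proof -
    have "A i j \<in> {1, -1}" using A that by (auto simp: sign_matrix_def)
    then show ?thesis by auto
  qed
  have abs_t: "\<bar>t i j\<bar> = B ^ (i * j) * \<bar>x j\<bar>" if "i \<in> {1..r}" "j \<in> {1..n}" for i j
    using abs_A[OF that] B by (simp add: t_def abs_mult)
  have supp: "x j \<noteq> 0 \<Longrightarrow> j \<in> {1..n}" for j using x by (auto simp: lawrence_kernel_def)
  have n: "n \<ge> 1" using supp[OF x0] by auto
  have cross: "k \<le> k'" if "near i k" "near (Suc i) k'" "i \<in> {1..r}" "Suc i \<in> {1..r}" for i k k'
  proof (rule ccontr)
    assume "\<not> k \<le> k'"
    then have le: "Suc k' \<le> k" by simp
    have k: "k \<in> {1..n}" "k' \<in> {1..n}" "x k \<noteq> 0" using that by (auto simp: near_def)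
    have 1: "B ^ (i * k') * \<bar>x k'\<bar> \<le> real n * (B ^ (i * k) * \<bar>x k\<bar>)"
      using that k by (auto simp: near_def abs_t)
    have "B ^ (Suc i * k) * \<bar>x k\<bar> \<le> real n * (B ^ (Suc i * k') * \<bar>x k'\<bar>)"
      using that k unfolding near_def by (metis abs_t)
    also have "\<dots> = real n * B ^ k' * (B ^ (i * k') * \<bar>x k'\<bar>)"
      by (simp add: power_add algebra_simps)
    also have "\<dots> \<le> real n * B ^ k' * (real n * (B ^ (i * k) * \<bar>x k\<bar>))"
      using 1 B by (intro mult_left_mono) auto
    also have "\<dots> = ((real n)\<^sup>2 * B ^ k') * (B ^ (i * k) * \<bar>x k\<bar>)"
      by (simp add: power2_eq_square)
    finally have "B ^ k * (B ^ (i * k) * \<bar>x k\<bar>) \<le> ((real n)\<^sup>2 * B ^ k') * (B ^ (i * k) * \<bar>x k\<bar>)"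
      by (simp add: power_add algebra_simps)
    moreover have "B ^ (i * k) * \<bar>x k\<bar> > 0" using B k by simp
    ultimately have "B ^ k \<le> (real n)\<^sup>2 * B ^ k'" by (simp only: mult_le_cancel_right_pos)
    also have "\<dots> < B * B ^ k'" using B by (intro mult_strict_right_mono) auto
    also have "\<dots> \<le> B ^ k" using power_increasing[OF le B(1)] by simp
    finally show False by simp
  qed
  have "\<exists>lo hi. near i lo \<and> near i hi \<and> lo < hi \<and> t i lo * t i hi < 0" if i: "i \<in> {1..r}" for i
  proof -
    let ?S = "(\<lambda>q. \<bar>t i q\<bar>) ` {1..n}"
    have "Max ?S \<in> ?S" using n by (intro Max_in) auto
    then obtain p where p1: "p \<in> {1..n}" "Max ?S = \<bar>t i p\<bar>" by blast
    have "\<bar>t i q\<bar> \<le> \<bar>t i p\<bar>" if "q \<in> {1..n}" for q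
      unfolding p1(2)[symmetric] using that by (intro Max_ge) auto
    note p = p1(1) this
    have "\<bar>t i e0\<bar> > 0" using abs_t[OF i supp[OF x0]] x0 B by simp
    then have tp: "t i p \<noteq> 0" using p(2)[OF supp[OF x0]] by auto
    have "(\<Sum>j=1..n. t i j) = 0" using x i by (auto simp: lawrence_kernel_def t_def B_def)
    then obtain q where q: "q \<in> {1..n}" "t i q * t i p < 0" "\<bar>t i p\<bar> \<le> real n * \<bar>t i q\<bar>"
      using exists_opposite_large_term[where t = "t i" and p = p and n = n, OF _ p(1) tp p(2)] by blast
    have "x q \<noteq> 0" using q(2) by (auto simp: t_def)
    then have "near i q"
      unfolding near_def using q(1) order_trans[OF p(2) q(3)] by blast
    moreover have "near i p"
      unfolding near_def
    proof (intro conjI ballI)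
      fix k assume "k \<in> {1..n}"
      then have "\<bar>t i k\<bar> \<le> 1 * \<bar>t i p\<bar>" using p(2) by simp
      also have "\<dots> \<le> real n * \<bar>t i p\<bar>" using n by (intro mult_right_mono) auto
      finally show "\<bar>t i k\<bar> \<le> real n * \<bar>t i p\<bar>" .
    qed (use p tp in \<open>auto simp: t_def\<close>)
    moreover have "p \<noteq> q" using q(2) by (auto simp: mult_less_0_iff)
    ultimately show ?thesis
      using q(2) by (metis linorder_neqE_nat mult.commute)
  qed
  then obtain lo hi where lh: "\<And>i. i \<in> {1..r} \<Longrightarrow> near i (lo i) \<and> near i (hi i) \<and> lo i < hi i \<and>
      t i (lo i) * t i (hi i) < 0" by metis
  define T where "T j = (if x j > 0 then 1 else if x j < 0 then -1 else 0 :: int)" for j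
  have T: "of_int (T j) = sgn (x j)" for j by (auto simp: T_def)
  have "\<exists>Z\<in>circuits (lawrence_om r n A). \<forall>e. Z e \<noteq> 0 \<longrightarrow> Z e = T e"
  proof (rule conformal_circuit_of_sign_changes[OF A r,
        where lo = "\<lambda>i. lo (Suc i)" and hi = "\<lambda>i. hi (Suc i)"])
    fix i assume i: "Suc i < r"
    show "hi (Suc i) \<le> lo (Suc (Suc i))"
      using cross[of "Suc i"] lh[of "Suc i"] lh[of "Suc (Suc i)"] i by auto
  next
    fix i assume "i < r"
    then have i: "Suc i \<in> {1..r}" by auto
    let ?l = "lo (Suc i)" and ?h = "hi (Suc i)"
    show l: "?l \<in> {1..n} \<and> T ?l \<noteq> 0" and h: "?h \<in> {1..n} \<and> T ?h \<noteq> 0"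
      using lh[OF i] by (auto simp: near_def T_def)
    show "?l < ?h" using lh[OF i] by simp
    have a: "A (Suc i) ?l \<in> {1, -1}" "A (Suc i) ?h \<in> {1, -1}"
      using A i l h by (auto simp: sign_matrix_def)
    have "t (Suc i) ?l * t (Suc i) ?h =
      (B ^ (Suc i * ?l) * B ^ (Suc i * ?h)) * ((of_int (A (Suc i) ?l) * x ?l) * (of_int (A (Suc i) ?h) * x ?h))"
      by (simp add: t_def)
    then have "(of_int (A (Suc i) ?l) * x ?l) * (of_int (A (Suc i) ?h) * x ?h) < 0"
      using lh[OF i] B by (auto simp: mult_less_0_iff zero_less_mult_iff)
    then show "T ?h * A (Suc i) ?h = - (T ?l * A (Suc i) ?l)"
      using a by (auto simp: T_def mult_less_0_iff)
  qed (auto simp: T_def)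
  then show ?thesis using T by metis
qed

lemma homogeneous_system_nontrivial:
  fixes a :: "nat \<Rightarrow> nat \<Rightarrow> real"
  assumes "finite S" "card S = r + 1"
  shows "\<exists>x. (\<exists>j. x j \<noteq> 0) \<and> (\<forall>j. x j \<noteq> 0 \<longrightarrow> j \<in> S) \<and> (\<forall>i<r. (\<Sum>j\<in>S. a i j * x j) = 0)"
  using assms
proof (induction r arbitrary: S a)
  case 0
  then obtain s where "S = {s}" by (auto simp: card_1_singleton_iff)
  then show ?case by (intro exI[of _ "\<lambda>j. if j = s then 1 else 0"]) auto
next
  case (Suc r)
  show ?case
  proof (cases "\<exists>p\<in>S. a r p \<noteq> 0")
    case False
    from Suc obtain p where "p \<in> S" by fastforce
    obtain x where x: "\<exists>j. x j \<noteq> 0" "\<forall>j. x j \<noteq> 0 \<longrightarrow> j \<in> S - {p}"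
        "\<forall>i<r. (\<Sum>j\<in>S-{p}. a i j * x j) = 0"
      using Suc.IH[of "S - {p}" a] Suc.prems \<open>p \<in> S\<close> by auto
    have "x p = 0" using x(2) by auto
    then have "(\<Sum>j\<in>S. a i j * x j) = 0" if "i < r" for i
      using x(3) that Suc.prems(1) \<open>p \<in> S\<close> by (subst sum.remove[of _ p]) auto
    then show ?thesis using x False by (intro exI[of _ x]) (auto simp: less_Suc_eq)
  next
    case True
    then obtain p where p: "p \<in> S" "a r p \<noteq> 0" by blast
    define b where "b i j = a i j - a i p * a r j / a r p" for i j
    obtain x where x: "\<exists>j. x j \<noteq> 0" "\<forall>j. x j \<noteq> 0 \<longrightarrow> j \<in> S - {p}"
        "\<forall>i<r. (\<Sum>j\<in>S-{p}. b i j * x j) = 0"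
      using Suc.IH[of "S - {p}" b] Suc.prems p(1) by auto
    define c where "c = - (\<Sum>j\<in>S-{p}. a r j * x j) / a r p"
    define y where "y = x(p := c)"
    have sumy: "(\<Sum>j\<in>S. a i j * y j) = a i p * c + (\<Sum>j\<in>S-{p}. a i j * x j)" for i
      using Suc.prems(1) p(1) by (subst sum.remove[of _ p]) (auto simp: y_def intro!: sum.cong)
    have "(\<Sum>j\<in>S. a i j * y j) = 0" if "i < r" for i
    proof -
      have "0 = (\<Sum>j\<in>S-{p}. b i j * x j)" using x(3) that by simp
      also have "\<dots> = (\<Sum>j\<in>S-{p}. a i j * x j) - (\<Sum>j\<in>S-{p}. a i p / a r p * (a r j * x j))"
        by (simp add: b_def sum_subtractf[symmetric] left_diff_distrib mult.assoc)
      also have "(\<Sum>j\<in>S-{p}. a i p / a r p * (a r j * x j)) = - (a i p * c)"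
        by (simp add: c_def sum_distrib_left sum_divide_distrib)
      finally show ?thesis using sumy by simp
    qed
    moreover have "(\<Sum>j\<in>S. a r j * y j) = 0" using sumy[of r] p(2) by (simp add: c_def)
    moreover have "\<exists>j. y j \<noteq> 0" using x(1,2) by (auto simp: y_def)
    moreover have "\<forall>j. y j \<noteq> 0 \<longrightarrow> j \<in> S" using x(2) p(1) by (auto simp: y_def)
    ultimately show ?thesis by (intro exI[of _ y]) (auto simp: less_Suc_eq)
  qed
qed

lemma circuits_eq_or_opposite:
  assumes A: "sign_matrix r n A"
    and X: "X \<in> circuits (lawrence_om r n A)" and Y: "Y \<in> circuits (lawrence_om r n A)"
    and sub: "support X \<subseteq> support Y"
  shows "X = Y \<or> X = - Y"
proof -
  note X' = X[unfolded lawrence_circuits[OF A]] and Y' = Y[unfolded lawrence_circuits[OF A]]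
  have fin: "finite (support Y)" using Y' card.infinite by fastforce
  have eq: "support X = support Y" using card_subset_eq[OF fin sub] X' Y' by simp
  define js where "js = sorted_list_of_set (support Y)"
  have js: "set js = support Y" "length js = r + 1" using fin Y' by (auto simp: js_def)
  have cX: "chain r A X js" and cY: "chain r A Y js" using X' Y' eq by (auto simp: js_def)
  have mem: "js ! 0 \<in> support Y" using js by (metis nth_mem add_gr_0 zero_less_one)
  have "X (js ! 0) \<noteq> 0" "Y (js ! 0) \<noteq> 0" using mem eq by (auto simp: support_iff)
  moreover have "X (js ! 0) \<in> {-1, 0, 1}" "Y (js ! 0) \<in> {-1, 0, 1}"
    using X' Y' by (auto simp: sign_vectors_def)
  ultimately have "\<exists>s\<in>{1, -1}. X (js ! 0) = s * Y (js ! 0)" by auto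
  then obtain s where s: "s \<in> {1, -1}" "X (js ! 0) = s * Y (js ! 0)" by blast
  have "X (js ! k) = s * Y (js ! k)" if "k \<le> r" for k
    using that by (induction k) (use s cX cY in \<open>auto simp: chain_def\<close>)
  then have "X e = s * Y e" if "e \<in> support Y" for e
    using that js by (metis in_set_conv_nth Suc_eq_plus1 less_Suc_eq_le)
  moreover have "X e = s * Y e" if "e \<notin> support Y" for e
    using that eq support_iff[of e X] support_iff[of e Y] by auto
  ultimately have "X = (\<lambda>e. s * Y e)" by blast
  then show ?thesis using s(1) by (auto simp: fun_eq_iff)
qed

lemma uminus_circuit:
  assumes A: "sign_matrix r n A" and X: "X \<in> circuits (lawrence_om r n A)"
  shows "- X \<in> circuits (lawrence_om r n A)"
proof -
  have "support (- X) = support X" by (auto simp: support_iff)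
  moreover have "- X \<in> sign_vectors {1..n}" if "X \<in> sign_vectors {1..n}"
    using that calculation by (fastforce simp: sign_vectors_def)
  ultimately show ?thesis
    using X unfolding lawrence_circuits[OF A] by (auto simp: chain_def)
qed

lemma circuit_with_support:
  assumes A: "sign_matrix r n A" and r: "r \<ge> 1" and S: "S \<subseteq> {1..n}" "card S = r + 1"
  shows "\<exists>Z\<in>circuits (lawrence_om r n A). \<exists>x\<in>lawrence_kernel r n A.
           support Z = S \<and> (\<forall>e. of_int (Z e) = sgn (x e))"
proof -
  have fin: "finite S" using S finite_subset by auto
  obtain x where x: "\<exists>j. x j \<noteq> 0" "\<forall>j. x j \<noteq> 0 \<longrightarrow> j \<in> S"
    "\<forall>i<r. (\<Sum>j\<in>S. of_int (A (Suc i) j) * real (n\<^sup>2 + 1) ^ (Suc i * j) * x j) = 0"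
    using homogeneous_system_nontrivial[OF fin S(2),
      of "\<lambda>i j. of_int (A (Suc i) j) * real (n\<^sup>2 + 1) ^ (Suc i * j)"] by blast
  have K: "x \<in> lawrence_kernel r n A"
    unfolding lawrence_kernel_def
  proof (intro CollectI conjI ballI allI impI)
    fix i assume i: "i \<in> {1..r}"
    from i obtain i' where i': "i = Suc i'" "i' < r" by (cases i) auto
    have "(\<Sum>j=1..n. of_int (A i j) * real (n\<^sup>2 + 1) ^ (i * j) * x j) =
        (\<Sum>j\<in>S. of_int (A i j) * real (n\<^sup>2 + 1) ^ (i * j) * x j)"
      using S(1) x(2) by (intro sum.mono_neutral_right) auto
    also have "\<dots> = 0" unfolding i'(1) using x(3) i'(2) by blast
    finally show "(\<Sum>j=1..n. of_int (A i j) * real (n\<^sup>2 + 1) ^ (i * j) * x j) = 0" .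
  qed (use x(2) S(1) in blast)
  obtain e0 where "x e0 \<noteq> 0" using x(1) by blast
  then obtain Z where Z: "Z \<in> circuits (lawrence_om r n A)" "\<forall>e. Z e \<noteq> 0 \<longrightarrow> of_int (Z e) = sgn (x e)"
    using kernel_conformal_circuit[OF A r K] by blast
  have sub: "support Z \<subseteq> S"
  proof
    fix e assume "e \<in> support Z"
    then have "Z e \<noteq> 0" by (simp add: support_iff)
    then have "sgn (x e) \<noteq> 0" using Z(2) by (metis of_int_eq_0_iff)
    then show "e \<in> S" using x(2) by (auto simp: sgn_zero_iff)
  qed
  then have eq: "support Z = S"
    using card_subset_eq[OF fin sub] S(2) Z(1) by (simp add: lawrence_circuits[OF A])
  have "of_int (Z e) = sgn (x e)" for e
  proof (cases "Z e = 0")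
    case True
    then have "e \<notin> S" using eq support_iff[of e Z] by auto
    then have "x e = 0" using x(2) by blast
    then show ?thesis using True by simp
  qed (use Z(2) in blast)
  then show ?thesis using Z(1) K eq by blast
qed

lemma circuit_in_kernel:
  assumes A: "sign_matrix r n A" and r: "r \<ge> 1" and X: "X \<in> circuits (lawrence_om r n A)"
  shows "\<exists>x\<in>lawrence_kernel r n A. \<forall>e. of_int (X e) = sgn (x e)"
proof -
  have "support X \<subseteq> {1..n}" "card (support X) = r + 1"
    using X by (auto simp: lawrence_circuits[OF A] sign_vectors_def)
  from circuit_with_support[OF A r this] obtain Z x where Z: "Z \<in> circuits (lawrence_om r n A)"
    "x \<in> lawrence_kernel r n A" "support Z = support X" "\<forall>e. of_int (Z e) = sgn (x e)"
    by blast
  have "(\<lambda>j. - x j) \<in> lawrence_kernel r n A"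
    using Z(2) by (auto simp: lawrence_kernel_def sum_negf)
  moreover have "X = Z \<or> X = - Z" using circuits_eq_or_opposite[OF A X Z(1)] Z(3) by simp
  moreover have "\<forall>e. of_int ((- Z) e) = sgn (- x e)" using Z(4) by (simp add: sgn_minus)
  ultimately show ?thesis using Z(2,4)
    by (elim disjE) (auto intro: bexI[of _ "\<lambda>j. - x j"])
qed

lemma lawrence_elimination:
  assumes A: "sign_matrix r n A" and r: "r \<ge> 1"
    and X: "X \<in> circuits (lawrence_om r n A)" and Y: "Y \<in> circuits (lawrence_om r n A)"
    and e: "e \<in> positive X \<inter> negative Y" and ne: "X \<noteq> - Y"
  shows "\<exists>Z\<in>circuits (lawrence_om r n A). positive Z \<subseteq> (positive X \<union> positive Y) - {e} \<and>
           negative Z \<subseteq> (negative X \<union> negative Y) - {e}"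
proof -
  obtain x where x: "x \<in> lawrence_kernel r n A" "\<And>e. of_int (X e) = sgn (x e)"
    using circuit_in_kernel[OF A r X] by blast
  obtain y where y: "y \<in> lawrence_kernel r n A" "\<And>e. of_int (Y e) = sgn (y e)"
    using circuit_in_kernel[OF A r Y] by blast
  have Xpos: "X f > 0 \<longleftrightarrow> x f > 0" and Xneg: "X f < 0 \<longleftrightarrow> x f < 0" for f
    using x(2)[of f] by (auto simp: sgn_if split: if_splits)
  have Ypos: "Y f > 0 \<longleftrightarrow> y f > 0" and Yneg: "Y f < 0 \<longleftrightarrow> y f < 0" for f
    using y(2)[of f] by (auto simp: sgn_if split: if_splits)
  have xe: "x e > 0" and ye: "y e < 0"
    using e Xpos Yneg by (auto simp: positive_def negative_def)
  define w where "w f = - y e * x f + x e * y f" for f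
  have we: "w e = 0" by (simp add: w_def)
  have wpos: "x f > 0 \<or> y f > 0" if "w f > 0" for f
  proof (rule ccontr)
    assume "\<not> ?thesis"
    then have "- y e * x f \<le> 0" "x e * y f \<le> 0"
      using xe ye by (auto intro!: mult_nonneg_nonpos simp del: mult_minus_left)
    then show False using that by (simp add: w_def)
  qed
  have wneg: "x f < 0 \<or> y f < 0" if "w f < 0" for f
  proof (rule ccontr)
    assume "\<not> ?thesis"
    then have "- y e * x f \<ge> 0" "x e * y f \<ge> 0"
      using xe ye by (auto intro!: mult_nonneg_nonneg simp del: mult_minus_left)
    then show False using that by (simp add: w_def)
  qed
  have "w \<in> lawrence_kernel r n A"
    unfolding lawrence_kernel_def
  proof (intro CollectI conjI allI ballI impI)
    fix j assume "w j \<noteq> 0"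
    then have "x j \<noteq> 0 \<or> y j \<noteq> 0" by (auto simp: w_def)
    then show "j \<in> {1..n}" using x(1) y(1) by (auto simp: lawrence_kernel_def)
  next
    fix i assume "i \<in> {1..r}"
    define c where "c j = of_int (A i j) * real (n\<^sup>2 + 1) ^ (i * j)" for j
    have "(\<Sum>j=1..n. c j * x j) = 0" "(\<Sum>j=1..n. c j * y j) = 0"
      using x(1) y(1) \<open>i \<in> {1..r}\<close> by (auto simp: lawrence_kernel_def c_def)
    moreover have "(\<Sum>j=1..n. c j * w j) =
        - y e * (\<Sum>j=1..n. c j * x j) + x e * (\<Sum>j=1..n. c j * y j)"
      unfolding sum_distrib_left sum.distrib[symmetric]
      by (intro sum.cong) (auto simp: w_def algebra_simps)
    ultimately show "(\<Sum>j=1..n. of_int (A i j) * real (n\<^sup>2 + 1) ^ (i * j) * w j) = 0"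
      by (simp add: c_def)
  qed
  moreover have "\<exists>f. w f \<noteq> 0"
  proof (rule ccontr)
    assume "\<nexists>f. w f \<noteq> 0"
    then have w0: "x e * y f = y e * x f" for f by (simp add: w_def)
    have "X f = - Y f" for f
    proof -
      have "sgn (x e) * sgn (y f) = sgn (y e) * sgn (x f)"
        using w0[of f] by (metis sgn_mult)
      then have "sgn (y f) = - sgn (x f)" using xe ye by simp
      then have "real_of_int (X f) = real_of_int (- Y f)" using x(2)[of f] y(2)[of f] by simp
      then show ?thesis by linarith
    qed
    then show False using ne by auto
  qed
  ultimately obtain Z where Z: "Z \<in> circuits (lawrence_om r n A)"
    "\<forall>f. Z f \<noteq> 0 \<longrightarrow> of_int (Z f) = sgn (w f)"
    using kernel_conformal_circuit[OF A r] by blast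
  have pos: "w f > 0" if "Z f > 0" for f
  proof -
    have "sgn (w f) > 0" using that Z(2)[rule_format, of f] by (metis less_irrefl of_int_0_less_iff)
    then show ?thesis by simp
  qed
  have neg: "w f < 0" if "Z f < 0" for f
  proof -
    have "sgn (w f) < 0" using that Z(2)[rule_format, of f] by (metis less_irrefl of_int_less_0_iff)
    then show ?thesis by simp
  qed
  have "positive Z \<subseteq> (positive X \<union> positive Y) - {e}"
    using pos wpos we Xpos Ypos unfolding positive_def by fastforce
  moreover have "negative Z \<subseteq> (negative X \<union> negative Y) - {e}"
    using neg wneg we Xneg Yneg unfolding negative_def by fastforce
  ultimately show ?thesis using Z(1) by blast
qed

theorem lawrence_om_oriented_matroid:
  assumes A: "sign_matrix r n A" and r: "r \<ge> 1"
  shows "oriented_matroid (lawrence_om r n A)"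
  unfolding oriented_matroid_def ground_lawrence
proof (intro conjI ballI impI)
  show "circuits (lawrence_om r n A) \<subseteq> sign_vectors {1..n}"
    by (auto simp: lawrence_circuits[OF A])
  show "support X \<noteq> {}" if "X \<in> circuits (lawrence_om r n A)" for X
    using that by (auto simp: lawrence_circuits[OF A])
qed (use lawrence_elimination[OF A r] uminus_circuit[OF A] circuits_eq_or_opposite[OF A] in auto)

theorem is_lawrence_om_simple_uniform:
  assumes "is_lawrence_om r n M" "r \<ge> 2"
  shows "simple_om M \<and> uniform_of_rank r M"
proof -
  obtain A where A: "r \<le> n" "sign_matrix r n A" "M = lawrence_om r n A"
    using assms(1) by (auto simp: is_lawrence_om_def)
  note lc = lawrence_circuits[OF A(2)]
  have r: "r \<ge> 1" using assms(2) by simp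
  have "support ` circuits M = {S. S \<subseteq> ground M \<and> card S = r + 1}"
  proof (intro equalityI subsetI)
    fix S assume "S \<in> {S. S \<subseteq> ground M \<and> card S = r + 1}"
    then show "S \<in> support ` circuits M"
      using circuit_with_support[OF A(2) r, of S] A(3) by auto
  qed (use A(3) lc in \<open>force simp: sign_vectors_def\<close>)
  then show ?thesis
    using A lawrence_om_oriented_matroid[OF A(2) r] assms(2)
    by (auto simp: simple_om_def uniform_of_rank_def lc)
qed

theorem is_lawrence_om_alternating: "r \<le> n \<Longrightarrow> is_lawrence_om r n (alternating_om r n)"
  unfolding is_lawrence_om_def alternating_om_eq_lawrence
  by (auto simp: sign_matrix_def intro!: exI[of _ "\<lambda>_ _. 1"])

end

theory Submission
  imports Defs
begin

text \<open>Why the theorem holds. Reversing the elements of a set \<open>R\<close> turns the Lawrence oriented matroid of a sign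
matrix \<open>A\<close> into that of the matrix \<open>B\<close> obtained by negating the columns in \<open>R\<close>. It is
\<open>2\<close>-neighborly iff every circuit has at least three positive elements, the negative ones being
the positive ones of the opposite circuit. A circuit is an increasing path
\<open>j\<^sub>1 < \<dots> < j\<^sub>r\<^sub>+\<^sub>1\<close> whose sign changes between \<open>j\<^sub>i\<close> and \<open>j\<^sub>i\<^sub>+\<^sub>1\<close> according to row \<open>i\<close> of \<open>B\<close>, so the
least number of positive elements of an initial piece of a circuit obeys a recursion over the
columns of \<open>B\<close>. If \<open>n = r + m\<close>, then after \<open>c\<close> columns only pieces with \<open>c - m + 1\<close> to \<open>c\<close>
elements can still be completed. Hence \<open>B\<close> is read, column by column, by an automaton whose state consists
of \<open>m\<close> pairs of numbers (one for either sign of the last element, cut off at \<open>3\<close>), and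
\<open>f_num\<close> is the number of ways to choose signs for the columns of \<open>A\<close> such that the automaton
accepts (\<open>f_num_eq_count\<close>).

For the upper bound, define the potential of a state with no column to come as \<open>1\<close> or \<open>0\<close> according to
acceptance, and otherwise as the maximum, over all possible next columns, of the sum of the
potentials of the two successor states, one for each sign of the column. The potential dominates the count (\<open>count_le_potential\<close>). Negating a row of the
matrix exchanges the two numbers of a pair, so it suffices to tabulate a few hundred states with
\<open>m = 4\<close>, and the potential of the initial state with \<open>11\<close> columns to come is \<open>112\<close>. Although
the maximising columns are chosen separately in each state, the bound is attained.

A matrix attains the bound iff in every state that is reached the potential is exactly the sum of the potentials of
the two successors. This condition is checked along a search tree over the columns, which it
prunes so strongly that fewer than a thousand nodes remain (\<open>search_eq_card\<close>). The tree
enumerates normal forms of sign matrices: entries outside the band \<open>i \<le> j \<le> i + m\<close> have no influence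
on the circuits, and negating rows and columns makes the entries on the two boundary diagonals of the
band and in its first row equal to \<open>1\<close>. The
circuits recover the products of two entries of a row within the band, up to the signs of the two columns, and so every
reorientation class contains exactly one matroid of a normal form (\<open>exists_normal_form\<close>,
\<open>normal_form_unique\<close>). There are \<open>256\<close> normal forms that attain \<open>112\<close>. One of them is the
all-ones matrix, which represents the alternating oriented matroid.\<close>

section \<open>An automaton reading sign matrices by columns\<close>

text \<open>A profile \<open>(a, b)\<close> records, for pieces of circuits with a fixed number \<open>i\<close> of elements, the least number of positive
elements. The sign of the last element is compared with its entry in row \<open>i\<close>: \<open>a\<close> belongs to
equal and \<open>b\<close> to opposite signs. A column lists the entries of a matrix column from the top row
of the band to the bottom one, \<open>True\<close> standing for \<open>1\<close>.\<close>

type_synonym profile = "nat \<times> nat"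
type_synonym state = "profile list"
type_synonym column = "bool list"

text \<open>Appending one element whose entry in the row left behind is \<open>x\<close> and in the next row is \<open>y\<close>. The sign
of the new element is opposite, relative to the first of the two rows, to that of its predecessor.
Hence a positive new element has a predecessor of type \<open>\<not> x\<close> and itself gets type \<open>y\<close>. Numbers
above \<open>2\<close> need not be distinguished, and this cut-off keeps the automaton finite.\<close>

fun push :: "bool \<Rightarrow> bool \<Rightarrow> profile \<Rightarrow> profile" where
  "push x y (a, b) =
     (let u = (if x then b else a); u' = (if u < 3 then Suc u else u); w = (if x then a else b)
      in if y then (u', w) else (w, u'))"

fun pmin :: "profile \<Rightarrow> profile \<Rightarrow> profile" where
  "pmin (a, b) (c, d) = (min a c, min b d)"

text \<open>The pairs of a state belong to consecutive lengths \<open>i\<close>. The window moves up by one length with each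
column: a piece with \<open>i\<close> elements either ends before the new column or is a shorter piece extended
by it.\<close>

fun step :: "state \<Rightarrow> column \<Rightarrow> state" where
  "step [q] [x, y] = [push x y q]"
| "step (p # q # s) (x # y # ys) = pmin q (push x y p) # step (q # s) (y # ys)"
| "step _ _ = []"

text \<open>After the last column the first pair of the window belongs to complete circuits.\<close>

fun alive :: "state \<Rightarrow> bool" where
  "alive ((a, b) # s) = (2 < a \<and> 2 < b)"
| "alive [] = False"

text \<open>Before the first column only the empty piece exists. It precedes elements of either sign, and its
length \<open>0\<close> is the last one in the window.\<close>

definition initial :: "nat \<Rightarrow> state" where
  "initial m = replicate (m - 1) (3, 3) @ [(0, 0)]"

fun count :: "state \<Rightarrow> column list \<Rightarrow> nat" where
  "count s [] = (if alive s then 1 else 0)"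
| "count s (x # xs) = count (step s x) xs + count (step s (map Not x)) xs"

fun psort :: "profile \<Rightarrow> profile" where
  "psort (a, b) = (if a \<le> b then (a, b) else (b, a))"

definition canon :: "state \<Rightarrow> state" where
  "canon = map psort"

text \<open>Flipping a pair is the effect of negating a row of the matrix. \<open>True\<close> stands for the identity, so that
flips act on the entries of a column by \<open>(=)\<close>.\<close>

definition flip :: "bool \<Rightarrow> profile \<Rightarrow> profile" where
  "flip b q = (if b then q else prod.swap q)"

definition flips :: "bool list \<Rightarrow> state \<Rightarrow> state" where
  "flips e s = map2 flip e s"

lemma flips_simps [simp]: "flips [] s = []" "flips (b # e) (q # s) = flip b q # flips e s"
  by (simp_all add: flips_def)

lemma push_flip: "push x y (flip b q) = push (x = b) y q"
  by (cases q; cases x; cases b; simp add: flip_def Let_def)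

lemma flip_push: "push x (y = b) q = flip b (push x y q)"
  by (cases q; cases y; cases b; simp add: flip_def Let_def)

lemma pmin_flip: "pmin (flip b p) (flip b q) = flip b (pmin p q)"
  by (cases p; cases q; cases b; simp add: flip_def)

lemma psort_flip [simp]: "psort (flip b q) = psort q"
  by (cases q; cases b; auto simp add: flip_def)

lemma psort_eq_imp_flip: "psort p = psort q \<Longrightarrow> \<exists>b. p = flip b q"
  by (cases p; cases q; auto simp: flip_def split: if_splits)

lemma length_step: "length x = Suc (length s) \<Longrightarrow> length (step s x) = length s"
  by (induction s x rule: step.induct) auto

text \<open>The row that enters the window with the new column is not flipped, and the flip of the row that
leaves it only affects the reading of the column.\<close>

lemma step_flips:
  "length e = length s \<Longrightarrow> length x = Suc (length s) \<Longrightarrow> s \<noteq> [] \<Longrightarrow>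
   step (flips e s) x = flips (tl e @ [True]) (step s (map2 (=) x (e @ [True])))"
proof (induction s x arbitrary: e rule: step.induct)
  case (1 q x y)
  then obtain b where "e = [b]" by (cases e) auto
  then show ?case by (simp add: push_flip) (simp add: flip_def)
next
  case (2 p q s x y ys)
  then obtain b c e' where e: "e = b # c # e'" by (cases e; cases "tl e") auto
  have "push x y (flip b p) = flip c (push (x = b) (y = c) p)"
    by (simp only: push_flip flip_push) (simp add: flip_def prod.swap_def del: push.simps)
  then show ?case using 2(1)[of "c # e'"] 2(2-4) e by (simp add: pmin_flip del: push.simps)
qed auto

lemma canon_flips: "length e = length s \<Longrightarrow> canon (flips e s) = canon s"
  by (induction e s rule: list_induct2) (auto simp: canon_def)

lemma canon_eq_imp_flips: "canon s = canon c \<Longrightarrow> \<exists>e. length e = length c \<and> s = flips e c"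
proof (induction c arbitrary: s)
  case (Cons q c)
  then obtain p s' where s: "s = p # s'" "psort p = psort q" "canon s' = canon c"
    by (cases s) (auto simp: canon_def)
  obtain b where "p = flip b q" using psort_eq_imp_flip[OF s(2)] by blast
  moreover obtain e where "length e = length c" "s' = flips e c" using Cons.IH[OF s(3)] by blast
  ultimately show ?case using s(1) by (intro exI[of _ "b # e"]) simp
qed (simp add: canon_def)

lemma psort_push: "psort (push x y q) = psort (push x True q)"
  by (cases q; cases x; cases y) (auto simp: Let_def)

text \<open>The last entry of a column belongs to the row that enters the window, so that negating it amounts to a flip
of the new pair.\<close>

lemma canon_step_last:
  "length xs = length s \<Longrightarrow> canon (step s (xs @ [b])) = canon (step s (xs @ [b']))"
proof (induction s arbitrary: xs rule: induct_list012)
  case 1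
  then show ?case by simp
next
  case (2 q)
  then obtain x where "xs = [x]" by (cases xs) auto
  then show ?case using psort_push[of x b q] psort_push[of x b' q] by (simp add: canon_def del: push.simps)
next
  case (3 p q s)
  then obtain x y zs where "xs = x # y # zs" by (cases xs; cases "tl xs") auto
  then show ?case using 3(2)[of "y # zs"] 3(3) by (simp add: canon_def del: push.simps)
qed

lemma alive_flips: "length e = length s \<Longrightarrow> alive (flips e s) = alive s"
  by (induction e s rule: list_induct2) (auto simp: flip_def)

section \<open>Potentials\<close>

fun flat :: "state \<Rightarrow> nat list" where
  "flat [] = []"
| "flat ((a, b) # s) = a # b # flat s"

text \<open>The tables below are tries whose keys are lists of naturals. Each number is read in unary, so that all
operations unfold by constructor patterns and stay cheap under rewriting.\<close>

datatype trie = Empty | Leaf nat | Node trie trie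

fun get :: "trie \<Rightarrow> nat list \<Rightarrow> nat option" where
  "get (Leaf v) [] = Some v"
| "get (Node l r) (0 # ks) = get l ks"
| "get (Node l r) (Suc k # ks) = get r (k # ks)"
| "get _ _ = None"

fun put :: "trie \<Rightarrow> nat list \<Rightarrow> nat \<Rightarrow> trie" where
  "put t [] v = Leaf v"
| "put Empty (0 # ks) v = Node (put Empty ks v) Empty"
| "put Empty (Suc k # ks) v = Node Empty (put Empty (k # ks) v)"
| "put (Node l r) (0 # ks) v = Node (put l ks v) r"
| "put (Node l r) (Suc k # ks) v = Node l (put r (k # ks) v)"
| "put (Leaf w) (k # ks) v = Leaf w"

fun value_or_bound :: "nat \<Rightarrow> nat option \<Rightarrow> nat" where
  "value_or_bound n None = 2 ^ n"
| "value_or_bound n (Some v) = v"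

text \<open>A state missing from the table gets the trivial bound \<open>2 ^ n\<close> on the number of sign choices for
\<open>n\<close> columns. So a table is sound whichever states it lists.\<close>

definition potential :: "nat \<Rightarrow> trie \<Rightarrow> state \<Rightarrow> nat" where
  "potential n t s = value_or_bound n (get t (flat (canon s)))"

text \<open>Negating the whole column exchanges the two successors of a state, and negating its last entry
flips a pair of both. It therefore suffices to maximise over columns that begin and end with
\<open>True\<close>.\<close>

definition patterns :: "nat \<Rightarrow> column list" where
  "patterns m = product_lists ([True] # replicate (m - 1) [True, False] @ [[True]])"

fun spread :: "state \<Rightarrow> column list \<Rightarrow> state list" where
  "spread s [] = []"
| "spread s (x # xs) = step s x # step s (map Not x) # spread s xs"

text \<open>Removal of duplicates, with a trie of the states seen so far. Deciding by the shape of an argument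
that is already evaluated, rather than by a conditional, saves rewriting from traversing the trie
again in the chosen branch; \<open>advance\<close> below is written this way for the same reason.\<close>

fun note_found :: "nat option \<Rightarrow> state \<Rightarrow> state list \<times> trie \<Rightarrow> state list \<times> trie" where
  "note_found None s (ss, t) = (s # ss, put t (flat s) 0)"
| "note_found (Some v) s (ss, t) = (ss, t)"

fun enter :: "state \<Rightarrow> state list \<times> trie \<Rightarrow> state list \<times> trie" where
  "enter s (ss, t) = note_found (get t (flat s)) s (ss, t)"

definition dedupe :: "state list \<Rightarrow> state list" where
  "dedupe ss = fst (fold enter ss ([], Empty))"

text \<open>The states, up to flips, that arise from those in \<open>ss\<close> by one more column.\<close>

definition layer :: "nat \<Rightarrow> state list \<Rightarrow> state list" where
  "layer m ss = dedupe (map canon (concat (map (\<lambda>s. spread s (patterns m)) ss)))"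

fun best :: "nat \<Rightarrow> trie \<Rightarrow> state \<Rightarrow> column list \<Rightarrow> nat" where
  "best n t s [] = 0"
| "best n t s (x # xs) =
     max (potential n t (step s x) + potential n t (step s (map Not x))) (best n t s xs)"

fun final_table :: "state list \<Rightarrow> trie" where
  "final_table [] = Empty"
| "final_table (s # ss) = put (final_table ss) (flat (canon s)) (if alive s then 1 else 0)"

fun table :: "nat \<Rightarrow> nat \<Rightarrow> trie \<Rightarrow> state list \<Rightarrow> trie" where
  "table m n t [] = Empty"
| "table m n t (s # ss) = put (table m n t ss) (flat (canon s)) (best n t s (patterns m))"

fun add_table :: "nat \<Rightarrow> nat \<Rightarrow> state list \<Rightarrow> trie list \<Rightarrow> trie list" where
  "add_table m n ss ts = table m n (hd ts) ss # ts"

fun tables :: "nat \<Rightarrow> nat \<Rightarrow> state list \<Rightarrow> trie list" where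
  "tables m 0 ss = [final_table ss]"
| "tables m (Suc n) ss = add_table m n ss (tables m n (layer m ss))"

lemma flat_inject: "flat s = flat s' \<Longrightarrow> s = s'"
proof (induction s arbitrary: s' rule: flat.induct)
  case 1 then show ?case by (cases s' rule: flat.cases) auto
next
  case 2 then show ?case by (cases s' rule: flat.cases) auto
qed

lemma get_Node: "get (Node l r) ks = Some w \<longleftrightarrow>
    (\<exists>ks'. ks = 0 # ks' \<and> get l ks' = Some w) \<or> (\<exists>k ks'. ks = Suc k # ks' \<and> get r (k # ks') = Some w)"
proof (cases ks)
  case (Cons k ks')
  then show ?thesis by (cases k) auto
qed simp

lemma get_put: "get (put t ks v) ks' = Some w \<Longrightarrow> ks' = ks \<and> w = v \<or> get t ks' = Some w"
proof (induction t ks v arbitrary: ks' rule: put.induct)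
  case (1 t v)
  then show ?case by (cases ks') auto
qed (fastforce simp: get_Node)+

lemma set_dedupe: "set (dedupe ss) = set ss"
proof -
  have "set (fst (fold enter ss a)) = set (fst a) \<union> set ss"
    if "\<forall>s v. get (snd a) (flat s) = Some v \<longrightarrow> s \<in> set (fst a)" for a
    using that
  proof (induction ss arbitrary: a)
    case (Cons s ss)
    obtain l t where a: "a = (l, t)" by fastforce
    show ?case
    proof (cases "get t (flat s)")
      case None
      have "\<forall>s' v. get (put t (flat s) 0) (flat s') = Some v \<longrightarrow> s' \<in> set (s # l)"
        using Cons.prems a get_put[of t "flat s" 0] flat_inject by fastforce
      then show ?thesis using None a Cons.IH[of "(s # l, put t (flat s) 0)"] by simp
    next
      case (Some v)
      then have "s \<in> set l" using Cons.prems a by auto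
      then show ?thesis using Some a Cons by auto
    qed
  qed simp
  from this[of "([], Empty)"] show ?thesis by (simp add: dedupe_def)
qed

lemma potential_cong: "canon s = canon s' \<Longrightarrow> potential n t s = potential n t s'"
  by (simp add: potential_def)

lemma best_ge: "x \<in> set xs \<Longrightarrow> potential n t (step s x) + potential n t (step s (map Not x)) \<le> best n t s xs"
  by (induction xs) auto

lemma best_le: "(\<And>s. potential n t s \<le> 2 ^ n) \<Longrightarrow> best n t s xs \<le> 2 ^ Suc n"
  by (induction xs) (auto simp: mult_2 intro: add_mono)

text \<open>Columns of any shape are covered by the patterns, by the two symmetries just mentioned.\<close>

lemma best_patterns_ge:
  assumes "length s = m" "length x = Suc m" "m \<ge> 1"
  shows "potential n t (step s x) + potential n t (step s (map Not x)) \<le> best n t s (patterns m)"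
proof -
  obtain a y b where x: "x = a # y @ [b]" "length y = m - 1"
    using assms(2,3) by (metis Suc_diff_1 length_Suc_conv length_append_singleton nat.inject rev_exhaust length_0_conv not_one_le_zero neq0_conv)
  define z where "z = True # (if a then y else map Not y) @ [True]"
  have last: "potential n t (step s (xs @ [c])) = potential n t (step s (xs @ [d]))" if "length xs = m" for xs c d
    using canon_step_last[of xs s c d] that assms(1) potential_cong by metis
  have m: "length (a # y) = m" "length (True # y) = m" "length (False # y) = m"
     "length (True # map Not y) = m" "length (False # map Not y) = m" using x(2) assms(3) by auto
  have nn: "map (Not \<circ> Not) y = y" by (simp add: comp_def)
  have "z \<in> set (patterns m)"
  proof -
    have "list_all2 (\<lambda>x ys. x \<in> set ys) w (replicate k [True, False])" if "length w = k" for w k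
      using that by (auto simp: list_all2_conv_all_nth)
    from this[of y "m - 1"] this[of "map Not y" "m - 1"] show ?thesis
      unfolding patterns_def product_lists_set z_def using x(2) by (auto intro!: list_all2_appendI)
  qed
  moreover have "potential n t (step s x) + potential n t (step s (map Not x)) =
     potential n t (step s z) + potential n t (step s (map Not z))"
  proof (cases a)
    case True
    then show ?thesis using last[OF m(2), of b True] last[OF m(5), of "\<not> b" False]
      by (simp add: x z_def)
  next
    case False
    then show ?thesis using last[OF m(3), of b False] last[OF m(4), of "\<not> b" True]
      by (simp add: x z_def nn)
  qed
  ultimately show ?thesis using best_ge by metis
qed

lemma get_table:
  "get (table m n t ss) ks = Some v \<Longrightarrow> \<exists>c. ks = flat (canon c) \<and> v = best n t c (patterns m)"
  by (induction ss) (auto dest: get_put)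

lemma get_final_table:
  "get (final_table ss) ks = Some v \<Longrightarrow> \<exists>c. ks = flat (canon c) \<and> v = (if alive c then 1 else 0)"
proof (induction ss)
  case (Cons s ss)
  then show ?case using get_put[OF Cons.prems(1)[unfolded final_table.simps]] by blast
qed simp

text \<open>The head of the list is the table for all columns still to come, its tail serves the states after
the next column.\<close>

fun superharmonic :: "nat \<Rightarrow> trie list \<Rightarrow> bool" where
  "superharmonic m [] \<longleftrightarrow> False"
| "superharmonic m [t] \<longleftrightarrow> (\<forall>s. length s = m \<longrightarrow> (if alive s then 1 else 0) \<le> potential 0 t s)"
| "superharmonic m (t # u # ts) \<longleftrightarrow> superharmonic m (u # ts) \<and>
    (\<forall>s x. length s = m \<longrightarrow> length x = Suc m \<longrightarrow>
       potential (length ts) u (step s x) + potential (length ts) u (step s (map Not x)) \<le> potential (Suc (length ts)) t s)"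

text \<open>The two successors of a state split its sign choices, as the two summands split its potential.\<close>

lemma count_le_potential:
  "superharmonic m ts \<Longrightarrow> length ts = Suc (length xs) \<Longrightarrow> length s = m \<Longrightarrow>
   \<forall>x\<in>set xs. length x = Suc m \<Longrightarrow> count s xs \<le> potential (length xs) (hd ts) s"
proof (induction xs arbitrary: s ts)
  case Nil
  then show ?case by (cases ts) auto
next
  case (Cons x xs)
  then obtain t u ts' where ts: "ts = t # u # ts'"
    by (metis Suc_length_conv length_Cons)
  have "count (step s y) xs \<le> potential (length xs) u (step s y)" if "length y = Suc m" for y
    using Cons.IH[of "u # ts'" "step s y"] Cons.prems ts that by (auto simp: length_step)
  from this[of x] this[of "map Not x"] have
    "count s (x # xs) \<le> potential (length xs) u (step s x) + potential (length xs) u (step s (map Not x))"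
    using Cons.prems(4) by (simp add: add_mono)
  also have "\<dots> \<le> potential (length (x # xs)) (hd ts) s" using Cons.prems ts by simp
  finally show ?case .
qed

text \<open>For a tabulated state the inequality holds since its value was computed as a maximum over all columns; it passes
to flipped states because flips commute with \<open>step\<close> up to a change of the column. For any other
state the value \<open>2 ^ Suc n\<close> is large enough as no potential for \<open>n\<close> columns exceeds
\<open>2 ^ n\<close>; this bound is carried along in the induction.\<close>

lemma superharmonic_tables:
  assumes "m \<ge> 1"
  shows "superharmonic m (tables m n ss) \<and> length (tables m n ss) = Suc n \<and>
         (\<forall>s. potential n (hd (tables m n ss)) s \<le> 2 ^ n)"
proof (induction n arbitrary: ss)
  case 0
  have "(if alive s then 1 else 0) \<le> potential 0 (final_table ss) s \<and> potential 0 (final_table ss) s \<le> 1" for s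
  proof (cases "get (final_table ss) (flat (canon s))")
    case (Some v)
    then obtain c where c: "canon s = canon c" "v = (if alive c then 1 else 0)"
      using get_final_table flat_inject by metis
    then have "alive s = alive c" using canon_eq_imp_flips alive_flips by metis
    then show ?thesis using c Some by (simp add: potential_def)
  qed (simp add: potential_def)
  then show ?case by simp
next
  case (Suc n)
  define us where "us = tables m n (layer m ss)"
  obtain u us' where us: "us = u # us'" "length us' = n" "superharmonic m us" "\<And>s. potential n u s \<le> 2 ^ n"
    using Suc[of "layer m ss"] unfolding us_def[symmetric] by (cases us) auto
  define t where "t = table m n u ss"
  have t: "tables m (Suc n) ss = t # u # us'" by (simp add: t_def us_def[symmetric] us(1))
  have bound: "potential (Suc n) t s \<le> 2 ^ Suc n" for s
    using get_table[of m n u ss] best_le[OF us(4)]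
    by (cases "get t (flat (canon s))") (fastforce simp: potential_def t_def)+
  have "potential n u (step s x) + potential n u (step s (map Not x)) \<le> potential (Suc n) t s"
    if s: "length s = m" and x: "length x = Suc m" for s x
  proof (cases "get t (flat (canon s))")
    case None
    then have "potential (Suc n) t s = 2 ^ n + 2 ^ n" by (simp add: potential_def)
    then show ?thesis using us(4) add_mono by metis
  next
    case (Some v)
    then obtain c where c: "canon s = canon c" and v: "v = best n u c (patterns m)"
      using get_table flat_inject unfolding t_def by metis
    from canon_eq_imp_flips[OF c] obtain e where e: "length e = length c" "s = flips e c" by blast
    have lc: "length c = m" using e s by (simp add: flips_def)
    define y where "y = map2 (=) x (e @ [True])"
    have ly: "length y = Suc m" using x e lc by (simp add: y_def)
    have ny: "map2 (=) (map Not x) (e @ [True]) = map Not y"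
      by (rule nth_equalityI) (auto simp: y_def)
    have c0: "c \<noteq> []" "Suc (length e - Suc 0) = length e" using e(1) lc assms by auto
    have st: "potential n u (step s z) = potential n u (step c (map2 (=) z (e @ [True])))" if "length z = Suc m" for z
      unfolding e(2) using e lc that c0
      by (subst step_flips) (auto intro!: potential_cong canon_flips simp: length_step)
    show ?thesis
      using best_patterns_ge[OF lc ly assms, of n u] Some v st[OF x] st[of "map Not x"] x ny
      by (simp add: potential_def[of "Suc n"] y_def[symmetric])
  qed
  then show ?case unfolding t using us bound by simp
qed

section \<open>The matrices that attain the bound\<close>

definition tight :: "nat \<Rightarrow> trie \<Rightarrow> trie \<Rightarrow> column \<Rightarrow> state \<Rightarrow> bool" where
  "tight n t u x s \<longleftrightarrow> potential (Suc n) t s = potential n u (step s x) + potential n u (step s (map Not x))"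

fun all_tight :: "nat \<Rightarrow> trie \<Rightarrow> trie \<Rightarrow> column \<Rightarrow> state list \<Rightarrow> bool" where
  "all_tight n t u x [] = True"
| "all_tight n t u x (s # ss) = (tight n t u x s \<and> all_tight n t u x ss)"

fun all_exact :: "trie \<Rightarrow> state list \<Rightarrow> bool" where
  "all_exact t [] = True"
| "all_exact t (s # ss) = (potential 0 t s = (if alive s then 1 else 0) \<and> all_exact t ss)"

text \<open>States of potential \<open>0\<close> attain their potential whatever follows, so they are dropped.\<close>

definition successors :: "nat \<Rightarrow> trie \<Rightarrow> column \<Rightarrow> state list \<Rightarrow> state list" where
  "successors n t x ss =
     dedupe (filter (\<lambda>s. potential n t s \<noteq> 0) (concat (map (\<lambda>s. spread s [x]) ss)))"

fun advance :: "bool \<Rightarrow> nat \<Rightarrow> trie \<Rightarrow> column \<Rightarrow> state list \<Rightarrow> state list option" where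
  "advance True n t x ss = Some (successors n t x ss)"
| "advance False n t x ss = None"

text \<open>Counts the sequences of columns, the \<open>j\<close>-th one taken from the \<open>j\<close>-th list of candidates, for which
all states in the given list attain their potential. The value \<open>None\<close> marks a branch in which a
state has already failed.\<close>

fun search :: "column list list \<Rightarrow> trie list \<Rightarrow> state list option \<Rightarrow> nat" where
  "search [] [t] (Some ss) = (if all_exact t ss then 1 else 0)"
| "search ((x # C) # Cs) (t # u # ts) (Some ss) =
     search Cs (u # ts) (advance (all_tight (length Cs) t u x ss) (length Cs) u x ss) +
     search (C # Cs) (t # u # ts) (Some ss)"
| "search Cs ts ss = 0"

lemma all_tight_iff: "all_tight n t u x ss \<longleftrightarrow> (\<forall>s\<in>set ss. tight n t u x s)"
  by (induction ss) auto

lemma all_exact_iff: "all_exact t ss \<longleftrightarrow> (\<forall>s\<in>set ss. potential 0 t s = (if alive s then 1 else 0))"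
  by (induction ss) auto

lemma search_None [simp]: "search Cs ts None = 0"
  by (cases "(Cs, ts, None :: state list option)" rule: search.cases) auto

lemma search_Cons:
  "distinct C \<Longrightarrow> search (C # Cs) (t # u # ts) (Some ss) =
   (\<Sum>x\<in>set C. if all_tight (length Cs) t u x ss
      then search Cs (u # ts) (Some (successors (length Cs) u x ss)) else 0)"
  by (induction C) auto

text \<open>The counts of both successors are bounded by their potentials, whose sum is at most the potential of the state. Hence
the count of a state reaches its potential iff this sum is tight and both successors reach theirs,
and the search may look at each state on its own.\<close>

lemma search_eq_card:
  "superharmonic m ts \<Longrightarrow> length ts = Suc (length Cs) \<Longrightarrow> \<forall>s\<in>set ss. length s = m \<Longrightarrow>
   \<forall>C\<in>set Cs. distinct C \<and> (\<forall>x\<in>set C. length x = Suc m) \<Longrightarrow>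
   search Cs ts (Some ss) =
     card {xs \<in> set (product_lists Cs). \<forall>s\<in>set ss. count s xs = potential (length Cs) (hd ts) s}"
proof (induction Cs arbitrary: ts ss)
  case Nil
  then obtain t where ts: "ts = [t]" by (cases ts) auto
  have "(\<forall>s\<in>set ss. count s [] = potential 0 t s) = all_exact t ss"
    unfolding all_exact_iff count.simps by (intro ball_cong refl) (rule eq_commute)
  then have "{xs \<in> set (product_lists []). \<forall>s\<in>set ss. count s xs = potential (length []) (hd ts) s} =
    (if all_exact t ss then {[]} else {})"
    unfolding ts by (auto simp del: count.simps)
  then show ?case unfolding ts by simp
next
  case (Cons C Cs)
  let ?n = "length Cs"
  obtain t u ts' where ts: "ts = t # u # ts'" "length ts' = ?n"
    using Cons.prems(2) by (cases ts; cases "tl ts") auto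
  define good where "good ss ts xs \<longleftrightarrow> (\<forall>s\<in>set ss. count s xs = potential (length xs) (hd ts) s)"
    for ss ts and xs :: "column list"
  define G where "G x = {xs \<in> set (product_lists Cs). good ss ts (x # xs)}" for x
  have step: "card (G x) = (if all_tight ?n t u x ss
      then search Cs (u # ts') (Some (successors ?n u x ss)) else 0)" if x: "x \<in> set C" for x
  proof -
    have lx: "length x = Suc m" using Cons.prems(4) x by auto
    have sup: "potential ?n u (step s x) + potential ?n u (step s (map Not x)) \<le> potential (Suc ?n) t s"
      if "s \<in> set ss" for s using Cons.prems(1,3) ts lx that by simp
    have le: "count (step s y) xs \<le> potential ?n u (step s y)"
      if "s \<in> set ss" "xs \<in> set (product_lists Cs)" "length y = Suc m" for s y xs
    proof -
      have "\<forall>i<?n. xs ! i \<in> set (Cs ! i)" "length xs = ?n"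
        using that(2) by (auto simp: product_lists_set list_all2_conv_all_nth)
      then have "length xs = ?n" "\<forall>x\<in>set xs. length x = Suc m"
        using Cons.prems(4) by (auto simp: in_set_conv_nth) (metis nth_mem)
      then show ?thesis using count_le_potential[of m "u # ts'" xs "step s y"] Cons.prems(1,3) ts that
        by (auto simp: length_step)
    qed
    have len: "length xs = ?n" if "xs \<in> set (product_lists Cs)" for xs
      using that in_set_product_lists_length by blast
    let ?suc = "successors ?n u x ss"
    have set_suc: "set ?suc = {s' \<in> (\<Union>s\<in>set ss. {step s x, step s (map Not x)}). potential ?n u s' \<noteq> 0}"
      by (auto simp: successors_def set_dedupe)
    have iff: "good ss ts (x # xs) \<longleftrightarrow> all_tight ?n t u x ss \<and> good ?suc (u # ts') xs"
      if xs: "xs \<in> set (product_lists Cs)" for xs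
    proof -
      have 1: "count s (x # xs) = potential (Suc ?n) t s \<longleftrightarrow> tight ?n t u x s \<and>
          count (step s x) xs = potential ?n u (step s x) \<and>
          count (step s (map Not x)) xs = potential ?n u (step s (map Not x))" if "s \<in> set ss" for s
      proof -
        have "count (step s x) xs \<le> potential ?n u (step s x)"
          "count (step s (map Not x)) xs \<le> potential ?n u (step s (map Not x))"
          using le[OF that xs] lx by simp_all
        with sup[OF that] show ?thesis unfolding tight_def count.simps by linarith
      qed
      have 2: "good ?suc (u # ts') xs \<longleftrightarrow> (\<forall>s\<in>set ss. count (step s x) xs = potential ?n u (step s x) \<and>
          count (step s (map Not x)) xs = potential ?n u (step s (map Not x)))"
      proof -
        have "count s' xs = potential ?n u s'"
          if "s \<in> set ss" "s' = step s x \<or> s' = step s (map Not x)" "potential ?n u s' = 0" for s s'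
          using that le[OF that(1) xs, of x] le[OF that(1) xs, of "map Not x"] lx by auto
        then show ?thesis unfolding good_def set_suc len[OF xs] list.sel by blast
      qed
      show ?thesis unfolding 2 all_tight_iff using 1 len[OF xs] ts by (auto simp: good_def)
    qed
    have "search Cs (u # ts') (Some ?suc) = card {xs \<in> set (product_lists Cs). good ?suc (u # ts') xs}"
    proof -
      have "\<forall>s\<in>set ?suc. length s = m"
        unfolding set_suc using Cons.prems(3) lx by (auto simp: length_step)
      from Cons.IH[OF _ _ this, of "u # ts'"] show ?thesis
        using Cons.prems(1,4) ts len by (auto simp: good_def intro!: arg_cong[where f = card])
    qed
    moreover have "G x = (if all_tight ?n t u x ss then {xs \<in> set (product_lists Cs). good ?suc (u # ts') xs} else {})"
      using iff by (auto simp: G_def)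
    ultimately show ?thesis by simp
  qed
  have "G x = {xs \<in> set (product_lists Cs). \<forall>s\<in>set ss. count s (x # xs) = potential (Suc ?n) (hd ts) s}" for x
    by (auto simp: G_def good_def dest: in_set_product_lists_length)
  then have "{xs \<in> set (product_lists (C # Cs)). \<forall>s\<in>set ss. count s xs = potential (length (C # Cs)) (hd ts) s}
      = (\<Union>x\<in>set C. Cons x ` G x)"
    by (auto simp del: count.simps)
  moreover have "card (\<Union>x\<in>set C. Cons x ` G x) = (\<Sum>x\<in>set C. card (Cons x ` G x))"
    by (rule card_UN_disjoint) (auto simp: G_def)
  moreover have "card (Cons x ` G x) = card (G x)" for x by (rule card_image) simp
  moreover have "search (C # Cs) ts (Some ss) = (\<Sum>x\<in>set C. card (G x))"
    unfolding ts(1) using Cons.prems(4) step by (subst search_Cons) auto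
  ultimately show ?case by simp
qed

section \<open>Circuits as paths through the automaton\<close>

definition sign_of :: "bool \<Rightarrow> int" where
  "sign_of b = (if b then 1 else - 1)"

text \<open>Position \<open>k\<close> in column \<open>j\<close> belongs to row \<open>j + k - m\<close>. Outside the band, which no circuit visits,
the entries are set to \<open>1\<close>.\<close>

definition matrix_of :: "nat \<Rightarrow> column list \<Rightarrow> nat \<Rightarrow> nat \<Rightarrow> int" where
  "matrix_of m xs i j =
     (if 1 \<le> j \<and> j \<le> length xs \<and> i \<le> j \<and> j \<le> i + m then sign_of (xs ! (j - 1) ! (i + m - j)) else 1)"

text \<open>There is a piece of a circuit with \<open>i\<close> elements among the first \<open>c\<close> columns and at most \<open>p\<close> positive
elements such that \<open>v\<close> is the product of the last sign with its entry in row \<open>i\<close>. The empty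
piece qualifies for every \<open>v\<close>, as the first element of a circuit may have either sign.\<close>

fun light_path :: "(nat \<Rightarrow> nat \<Rightarrow> int) \<Rightarrow> nat \<Rightarrow> nat \<Rightarrow> int \<Rightarrow> nat \<Rightarrow> bool" where
  "light_path b c 0 v p = True"
| "light_path b 0 (Suc i) v p = False"
| "light_path b (Suc c) (Suc i) v p =
     (light_path b c (Suc i) v p \<or>
      (\<exists>X\<in>{1, -1}. v = X * b (Suc i) (Suc c) \<and> (X = 1 \<longrightarrow> 0 < p) \<and>
         light_path b c i (- X * b i (Suc c)) (if X = 1 then p - 1 else p)))"

lemma matrix_of_sign: "matrix_of m xs i j \<in> {1, -1}"
  by (simp add: matrix_of_def sign_of_def)

lemma light_path_mono: "light_path b c i v p \<Longrightarrow> c \<le> c' \<Longrightarrow> light_path b c' i v p"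
proof (induction c')
  case (Suc c')
  then show ?case by (cases i; cases "c = Suc c'") auto
qed (cases i; simp)

lemma light_path_imp_le: "light_path b c i v p \<Longrightarrow> i \<le> c"
  by (induction b c i v p rule: light_path.induct) fastforce+

definition level :: "int \<Rightarrow> profile \<Rightarrow> nat" where
  "level v q = (if v = 1 then fst q else snd q)"

text \<open>Pair \<open>k\<close> of the state reached after \<open>c\<close> columns describes the pieces of length
\<open>c + k + 1 - m\<close>. The numbers are only compared with \<open>p < 3\<close> because of the cut-off.\<close>

definition window :: "nat \<Rightarrow> (nat \<Rightarrow> nat \<Rightarrow> int) \<Rightarrow> nat \<Rightarrow> state \<Rightarrow> bool" where
  "window m b c s \<longleftrightarrow> length s = m \<and>
     (\<forall>k i v p. k < m \<longrightarrow> i + m = Suc (c + k) \<longrightarrow> v \<in> {1, -1} \<longrightarrow> p < 3 \<longrightarrow>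
        (level v (s ! k) \<le> p \<longleftrightarrow> light_path b c i v p))"

lemma nth_step:
  "length x = Suc (length s) \<Longrightarrow> k < length s \<Longrightarrow> step s x ! k =
    (if Suc k < length s then pmin (s ! Suc k) (push (x ! k) (x ! Suc k) (s ! k))
     else push (x ! k) (x ! Suc k) (s ! k))"
proof (induction s x arbitrary: k rule: step.induct)
  case (2 p q s x y ys)
  then show ?case by (cases k) (auto simp del: push.simps)
qed (auto simp del: push.simps)

lemma level_push_le:
  assumes "v \<in> {1, -1}" "x \<in> {1, -1}" "y \<in> {1, -1}" "p < 3"
  shows "level v (push (x = 1) (y = 1) q) \<le> p \<longleftrightarrow>
    (if v = y then 0 < p \<and> level (- x) q \<le> p - 1 else level x q \<le> p)"
  using assms by (cases q) (auto simp: level_def Let_def)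

lemma level_pmin_le: "level v (pmin q q') \<le> p \<longleftrightarrow> level v q \<le> p \<or> level v q' \<le> p"
  by (cases q; cases q') (auto simp: level_def)

text \<open>A light piece with \<open>i\<close> elements that uses the new column consists of the new element and a light piece with
\<open>i - 1\<close> elements, which is the previous pair of the old window; the case distinction in
\<open>level_push_le\<close> is that on the sign of the new element.\<close>

lemma window_step:
  assumes w: "window m b c s" and x: "length x = Suc m"
    and b: "\<And>i j. b i j \<in> {1, -1}"
    and e: "\<And>i k. k \<le> m \<Longrightarrow> i + m = Suc c + k \<Longrightarrow> x ! k = (b i (Suc c) = 1)"
  shows "window m b (Suc c) (step s x)"
  unfolding window_def
proof (intro conjI allI impI)
  have s: "length s = m" using w by (simp add: window_def)
  then show "length (step s x) = m" using x by (simp add: length_step)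
  have W: "level v (s ! k) \<le> p \<longleftrightarrow> light_path b c i v p"
    if "k < m" "i + m = Suc (c + k)" "v \<in> {1, -1}" "p < 3" for k i v p
    using w that unfolding window_def by blast
  fix k i v and p :: nat
  assume k: "k < m" and i: "i + m = Suc (Suc c + k)" and v: "v \<in> {1, -1 :: int}" and p: "p < 3"
  let ?q = "push (x ! k) (x ! Suc k) (s ! k)"
  have nth: "level v (step s x ! k) \<le> p \<longleftrightarrow> Suc k < m \<and> level v (s ! Suc k) \<le> p \<or> level v ?q \<le> p"
    using nth_step[of x s k] s x k by (simp add: level_pmin_le del: push.simps)
  show "level v (step s x ! k) \<le> p \<longleftrightarrow> light_path b (Suc c) i v p"
  proof (cases i)
    case 0
    then have "Suc k < m" using i by simp
    then show ?thesis using W[of "Suc k" 0 v p] 0 i v p nth by simp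
  next
    case (Suc i')
    have old: "Suc k < m \<and> level v (s ! Suc k) \<le> p \<longleftrightarrow> light_path b c (Suc i') v p"
    proof (cases "Suc k < m")
      case True
      then show ?thesis using W[of "Suc k" "Suc i'" v p] Suc i v p by simp
    next
      case False
      then have "Suc i' > c" using i k Suc by simp
      then show ?thesis using False light_path_imp_le[of b c "Suc i'"] by fastforce
    qed
    have X: "x ! k = (b i' (Suc c) = 1)" "x ! Suc k = (b (Suc i') (Suc c) = 1)"
      using e[of k i'] e[of "Suc k" "Suc i'"] k i Suc by auto
    have ki: "i' + m = Suc (c + k)" using i Suc by simp
    have "level v ?q \<le> p \<longleftrightarrow>
       (\<exists>X\<in>{1, -1}. v = X * b (Suc i') (Suc c) \<and> (X = 1 \<longrightarrow> 0 < p) \<and>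
         light_path b c i' (- X * b i' (Suc c)) (if X = 1 then p - 1 else p))"
      unfolding X level_push_le[OF v b b p]
      using W[OF k ki _ p, of "b i' (Suc c)"] W[OF k ki, of "- b i' (Suc c)" "p - 1"]
        b[of i' "Suc c"] b[of "Suc i'" "Suc c"] v p
      by (cases "v = b (Suc i') (Suc c)") auto
    then show ?thesis unfolding nth old Suc by simp
  qed
qed

lemma window_initial: "m \<ge> 1 \<Longrightarrow> window m b 0 (initial m)"
  unfolding window_def initial_def
proof (intro conjI allI impI)
  fix k i v and p :: nat
  assume "m \<ge> 1" "k < m" "i + m = Suc (0 + k)" "p < 3"
  then have "i = 0" "k = m - 1" by auto
  then show "level v ((replicate (m - 1) (3, 3) @ [(0, 0)]) ! k) \<le> p \<longleftrightarrow> light_path b 0 i v p"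
    by (simp add: nth_append level_def)
qed auto

lemma window_foldl:
  assumes "window m b c s" "\<And>i j. b i j \<in> {1, -1}" "\<forall>x\<in>set xs. length x = Suc m"
    and "\<And>i k l. k \<le> m \<Longrightarrow> l < length xs \<Longrightarrow> i + m = Suc c + l + k \<Longrightarrow>
           xs ! l ! k = (b i (Suc c + l) = 1)"
  shows "window m b (c + length xs) (foldl step s xs)"
  using assms
proof (induction xs arbitrary: c s)
  case (Cons x xs)
  have "window m b (Suc c) (step s x)"
    using Cons.prems(3) Cons.prems(4)[of _ 0] by (intro window_step Cons.prems(1,2)) auto
  moreover have "xs ! l ! k = (b i (Suc (Suc c) + l) = 1)"
    if "k \<le> m" "l < length xs" "i + m = Suc (Suc c) + l + k" for i k l
    using Cons.prems(4)[of k "Suc l" i] that by simp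
  ultimately show ?case using Cons.IH[of "Suc c" "step s x"] Cons.prems(2,3) by simp
qed simp

lemma alive_iff:
  assumes m: "m \<ge> 1" and xs: "length xs = r + m" "\<forall>x\<in>set xs. length x = Suc m"
  shows "alive (foldl step (initial m) xs) \<longleftrightarrow>
    \<not> (\<exists>v\<in>{1, -1}. light_path (matrix_of m xs) (r + m) (Suc r) v 2)"
proof -
  let ?s = "foldl step (initial m) xs"
  have "window m (matrix_of m xs) (0 + length xs) ?s"
  proof (rule window_foldl[OF window_initial[OF m] matrix_of_sign xs(2)])
    fix i k l assume "k \<le> m" "l < length xs" "i + m = Suc 0 + l + k"
    then show "xs ! l ! k = (matrix_of m xs i (Suc 0 + l) = 1)"
      by (simp add: matrix_of_def sign_of_def)
  qed
  then have w: "length ?s = m" "\<And>v. v \<in> {1, -1} \<Longrightarrow> level v (?s ! 0) \<le> 2 \<longleftrightarrow> light_path (matrix_of m xs) (r + m) (Suc r) v 2"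
    using m xs(1) by (auto simp: window_def)
  obtain a b s' where s: "?s = (a, b) # s'" using w(1) m by (cases ?s) auto
  show ?thesis using w(2)[of 1] w(2)[of "-1"] unfolding s by (auto simp: level_def)
qed

lemma chain_append: "k < length js \<Longrightarrow> chain k b X (js @ ys) = chain k b X js"
  by (auto simp: chain_def nth_append)

text \<open>By induction on the list from its end; the last element \<open>j\<close> is appended in step \<open>j\<close> of the
recursion, and later steps skip.\<close>

lemma light_path_of_list:
  assumes b: "\<And>i j. b i j \<in> {1, -1}"
  shows "sorted_wrt (<) js \<Longrightarrow> set js \<subseteq> {1..c} \<Longrightarrow> \<forall>j\<in>set js. X j \<in> {1, -1} \<Longrightarrow>
    chain (length js - 1) b X js \<Longrightarrow> card {j \<in> set js. X j = 1} \<le> p \<Longrightarrow>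
    js \<noteq> [] \<longrightarrow> v = X (last js) * b (length js) (last js) \<Longrightarrow> light_path b c (length js) v p"
proof (induction js arbitrary: c v p rule: rev_induct)
  case (snoc j js)
  obtain c' where j: "j = Suc c'" using snoc.prems(2) by (cases j) auto
  let ?l = "length js"
  have Xj: "X j \<in> {1, -1}" using snoc.prems(3) by simp
  have js: "sorted_wrt (<) js" "set js \<subseteq> {1..c'}" "j \<notin> set js"
    using snoc.prems(1,2) j by (fastforce simp: sorted_wrt_append)+
  have "{i \<in> set (js @ [j]). X i = 1} = (if X j = 1 then insert j {i \<in> set js. X i = 1} else {i \<in> set js. X i = 1})"
    by auto
  then have card: "card {i \<in> set js. X i = 1} \<le> (if X j = 1 then p - 1 else p)" "X j = 1 \<longrightarrow> 0 < p"
    using snoc.prems(5) js(3) by (auto split: if_splits)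
  have v: "js \<noteq> [] \<longrightarrow> - X j * b ?l j = X (last js) * b ?l (last js)"
  proof
    assume "js \<noteq> []"
    then obtain l where l: "?l = Suc l" by (cases js) auto
    then have "X j = - X (js ! l) * b ?l (js ! l) * b ?l j"
      using snoc.prems(4) by (auto simp: chain_def nth_append)
    moreover have "js ! l = last js" using l \<open>js \<noteq> []\<close> by (simp add: last_conv_nth)
    ultimately show "- X j * b ?l j = X (last js) * b ?l (last js)"
      using b[of ?l j] by auto
  qed
  have ch: "chain (?l - 1) b X js"
    using snoc.prems(4) chain_append[of "?l - 1" js b X "[j]"] by (cases js) (auto simp: chain_def)
  have "light_path b c' ?l (- X j * b ?l j) (if X j = 1 then p - 1 else p)"
    using snoc.prems(3) by (intro snoc.IH js ch card v) auto
  then have "light_path b (Suc c') (Suc ?l) v p"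
    using snoc.prems(6) Xj card(2) j by auto
  then show ?case using light_path_mono[of b "Suc c'" "Suc ?l" v p c] snoc.prems(2) j by simp
qed simp

lemma list_of_light_path:
  assumes b: "\<And>i j. b i j \<in> {1, -1}"
  shows "light_path b c i v p \<Longrightarrow> v \<in> {1, -1} \<Longrightarrow>
    \<exists>js X. sorted_wrt (<) js \<and> set js \<subseteq> {1..c} \<and> length js = i \<and> (\<forall>j\<in>set js. X j \<in> {1, -1}) \<and>
      chain (i - 1) b X js \<and> card {j \<in> set js. X j = 1} \<le> p \<and>
      (js \<noteq> [] \<longrightarrow> v = X (last js) * b i (last js))"
proof (induction b\<equiv>b c i v p rule: light_path.induct)
  case (3 c i v p)
  show ?case
  proof (cases "light_path b c (Suc i) v p")
    case True
    from 3(1)[OF this 3(4)] show ?thesis by fastforce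
  next
    case False
    then obtain Y where Y: "Y \<in> {1, -1}" "v = Y * b (Suc i) (Suc c)" "Y = 1 \<longrightarrow> 0 < p"
      "light_path b c i (- Y * b i (Suc c)) (if Y = 1 then p - 1 else p)"
      using 3(3) unfolding light_path.simps by blast
    have "- Y * b i (Suc c) \<in> {1, -1}" using Y(1) b[of i "Suc c"] by auto
    from 3(2)[OF Y(1,4) this] obtain js X where js: "sorted_wrt (<) js" "set js \<subseteq> {1..c}" "length js = i"
      "\<forall>j\<in>set js. X j \<in> {1, -1}" "chain (i - 1) b X js"
      "card {j \<in> set js. X j = 1} \<le> (if Y = 1 then p - 1 else p)"
      "js \<noteq> [] \<longrightarrow> - Y * b i (Suc c) = X (last js) * b i (last js)" by blast
    let ?js = "js @ [Suc c]" and ?X = "X(Suc c := Y)"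
    have nin: "Suc c \<notin> set js" using js(2) by auto
    have X: "?X j = X j" if "j \<in> set js" for j using that nin by auto
    have "chain i b ?X ?js"
      unfolding chain_def
    proof (intro allI impI)
      fix l assume l: "l < i"
      show "?X (?js ! Suc l) = - ?X (?js ! l) * b (Suc l) (?js ! l) * b (Suc l) (?js ! Suc l)"
      proof (cases "Suc l < i")
        case True
        then have "X (js ! Suc l) = - X (js ! l) * b (Suc l) (js ! l) * b (Suc l) (js ! Suc l)"
          using js(5) by (auto simp: chain_def)
        then show ?thesis using True l js(3) X[of "js ! l"] X[of "js ! Suc l"] by (simp add: nth_append)
      next
        case False
        then have i: "i = Suc l" using l by simp
        then have "js \<noteq> []" using js(3) by auto
        then have ne: "js \<noteq> []" "last js = js ! l" using i js(3) by (simp_all add: last_conv_nth)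
        then have "- Y * b i (Suc c) = X (js ! l) * b i (js ! l)" using js(7) by simp
        then have "Y = - X (js ! l) * b i (js ! l) * b i (Suc c)" using b[of i "Suc c"] by auto
        then show ?thesis using i js(3) X[of "js ! l"] by (simp add: nth_append)
      qed
    qed
    moreover have "card {j \<in> set ?js. ?X j = 1} \<le> p"
    proof -
      have "{j \<in> set ?js. ?X j = 1} = {j \<in> set js. X j = 1} \<union> (if Y = 1 then {Suc c} else {})"
        using nin by auto
      then show ?thesis using js(6) nin Y(3) by (auto split: if_splits)
    qed
    moreover have "sorted_wrt (<) ?js" "set ?js \<subseteq> {1..Suc c}"
      using js(1,2) by (force simp: sorted_wrt_append)+
    ultimately show ?thesis using js(3,4) Y(1,2)
      by (intro exI[of _ ?js] exI[of _ ?X]) auto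
  qed
qed (auto simp: chain_def intro: exI[of _ "[]"])

lemma light_path_iff_circuit:
  assumes b: "\<And>i j. b i j \<in> {1, -1}"
  shows "(\<exists>v\<in>{1, -1}. light_path b n (Suc r) v p) \<longleftrightarrow>
    (\<exists>Z\<in>circuits (lawrence_om r n b). card (positive Z) \<le> p)" (is "?L \<longleftrightarrow> ?R")
proof -
  have sm: "sign_matrix r n b" using b by (simp add: sign_matrix_def)
  note lc = lawrence_circuits[OF sm]
  show ?thesis
  proof
    assume ?L
    then obtain v where v: "v \<in> {1, -1}" "light_path b n (Suc r) v p" by blast
    obtain js X where js: "sorted_wrt (<) js" "set js \<subseteq> {1..n}" "length js = Suc r"
      "\<forall>j\<in>set js. X j \<in> {1, -1}" "chain r b X js" "card {j \<in> set js. X j = 1} \<le> p"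
      using list_of_light_path[OF b v(2,1)] unfolding diff_Suc_1 by blast
    define Z where "Z e = (if e \<in> set js then X e else 0)" for e
    have "X j \<noteq> 0" if "j \<in> set js" for j using js(4) that by fastforce
    then have supp: "support Z = set js" by (auto simp: support_iff Z_def split: if_splits)
    have sl: "sorted_list_of_set (set js) = js"
      using js(1) by (metis sorted_list_of_set.idem_if_sorted_distinct strict_sorted_iff)
    have "chain r b Z js" using js(3,5) by (simp add: chain_def Z_def)
    moreover have "card (set js) = r + 1"
      using js(1,3) by (metis Suc_eq_plus1 distinct_card strict_sorted_iff)
    moreover have "Z \<in> sign_vectors {1..n}"
      using js(2,4) supp by (auto simp: sign_vectors_def Z_def)
    ultimately have "Z \<in> circuits (lawrence_om r n b)"
      unfolding lc supp sl by blast
    moreover have "positive Z = {j \<in> set js. X j = 1}"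
      using js(4) by (force simp: positive_def Z_def)
    ultimately show ?R using js(6) by metis
  next
    assume ?R
    then obtain Z where Z: "Z \<in> circuits (lawrence_om r n b)" "card (positive Z) \<le> p" by blast
    define js where "js = sorted_list_of_set (support Z)"
    have "finite (support Z)" using Z(1) card.infinite unfolding lc by fastforce
    then have js: "set js = support Z" "sorted_wrt (<) js" "length js = Suc r" "set js \<subseteq> {1..n}"
      using Z(1) unfolding js_def lc by (auto simp: sign_vectors_def)
    have val: "Z j \<in> {1, -1}" if "j \<in> set js" for j
      using that Z(1) unfolding js(1) lc support_iff by (auto simp: sign_vectors_def)
    have "{j \<in> set js. Z j = 1} = {j \<in> set js. Z j > 0}" using val by force
    also have "\<dots> = positive Z" unfolding js(1) by (auto simp: positive_def support_iff)
    finally have pos: "{j \<in> set js. Z j = 1} = positive Z" .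
    define v where "v = Z (last js) * b (length js) (last js)"
    have "js \<noteq> []" using js(3) by auto
    then have "v \<in> {1, -1}" using val[of "last js"] b[of "length js" "last js"] by (auto simp: v_def)
    moreover have "chain (length js - 1) b Z js" using Z(1) js(3) by (simp add: lc js_def[symmetric])
    then have "light_path b n (length js) v p"
      using js Z(2) val pos by (intro light_path_of_list[OF b]) (auto simp: v_def)
    ultimately show ?L using js(3) by auto
  qed
qed

lemma neighborly_lawrence_iff:
  assumes "sign_matrix r n b"
  shows "neighborly k (lawrence_om r n b) \<longleftrightarrow>
    \<not> (\<exists>Z\<in>circuits (lawrence_om r n b). card (positive Z) \<le> k)"
proof -
  have "negative Z = positive (- Z)" for Z :: "nat sign_vector"
    by (auto simp: negative_def positive_def)
  then show ?thesis
    using uminus_circuit[OF assms] unfolding neighborly_def by (metis not_le)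
qed

lemma neighborly_iff_alive:
  assumes "m \<ge> 1" "length xs = r + m" "\<forall>x\<in>set xs. length x = Suc m"
  shows "neighborly 2 (lawrence_om r (r + m) (matrix_of m xs)) \<longleftrightarrow> alive (foldl step (initial m) xs)"
proof -
  have "sign_matrix r (r + m) (matrix_of m xs)" using matrix_of_sign by (simp add: sign_matrix_def)
  then show ?thesis
    unfolding neighborly_lawrence_iff[OF \<open>sign_matrix r (r + m) (matrix_of m xs)\<close>] alive_iff[OF assms]
    using light_path_iff_circuit[OF matrix_of_sign] by simp
qed

section \<open>Reorientation\<close>

definition orientation :: "nat set \<Rightarrow> nat \<Rightarrow> int" where
  "orientation R j = (if j \<in> R then -1 else 1)"

lemma circuits_reorient:
  "circuits (reorient R M) = {X. (\<lambda>e. if e \<in> R then - X e else X e) \<in> circuits M}"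
proof -
  define t :: "'a sign_vector \<Rightarrow> 'a sign_vector" where "t X e = (if e \<in> R then - X e else X e)" for X e
  have t: "t (t X) = X" for X by (simp add: fun_eq_iff t_def)
  have "t ` circuits M = {X. t X \<in> circuits M}"
    by (auto simp: t intro: image_eqI[of _ t "t _", OF t[symmetric]])
  then show ?thesis by (simp add: reorient_def t_def[abs_def])
qed

lemma ground_reorient [simp]: "ground (reorient R M) = ground M"
  by (simp add: reorient_def)

lemma reorient_reorient: "reorient S (reorient R M) = reorient (S - R \<union> (R - S)) M"
proof -
  have "(\<lambda>e. if e \<in> R then - (if e \<in> S then - X e else X e) else (if e \<in> S then - X e else X e)) =
     (\<lambda>e. if e \<in> S - R \<union> (R - S) then - X e else X e)" for X :: "'a sign_vector"
    by (auto simp: fun_eq_iff)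
  then have "circuits (reorient S (reorient R M)) = circuits (reorient (S - R \<union> (R - S)) M)"
    unfolding circuits_reorient by simp
  then show ?thesis by (metis ground_reorient signed_system.equality old.unit.exhaust)
qed

lemma reorient_empty: "reorient {} M = M"
proof -
  have "circuits (reorient {} M) = circuits M" unfolding circuits_reorient by simp
  then show ?thesis by (metis ground_reorient signed_system.equality old.unit.exhaust)
qed

lemma reorient_self_inverse: "reorient R (reorient R M) = M"
  by (simp add: reorient_reorient reorient_empty)

lemma reorientation_class_self: "M \<in> reorientation_class M"
  unfolding reorientation_class_def using reorient_empty by (metis (mono_tags, lifting) empty_subsetI mem_Collect_eq)

text \<open>Reorientations compose by symmetric difference, so they act as a group.\<close>

lemma reorientation_class_reorient:
  assumes "R \<subseteq> ground M"
  shows "reorientation_class (reorient R M) = reorientation_class M"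
proof -
  have sub: "reorientation_class (reorient R N) \<subseteq> reorientation_class N" if "R \<subseteq> ground N" for N :: "'a signed_system"
  proof
    fix L assume "L \<in> reorientation_class (reorient R N)"
    then obtain S where "S \<subseteq> ground N" "L = reorient (S - R \<union> (R - S)) N"
      by (auto simp: reorientation_class_def reorient_reorient)
    then show "L \<in> reorientation_class N"
      using that unfolding reorientation_class_def by blast
  qed
  show ?thesis
    using sub[of "reorient R M"] sub[of M] assms unfolding reorient_self_inverse ground_reorient
    by (intro equalityI)
qed

lemma mem_reorientation_class_iff:
  "M \<in> reorientation_class N \<longleftrightarrow> reorientation_class M = reorientation_class N"
proof
  assume "M \<in> reorientation_class N"
  then obtain R where "R \<subseteq> ground N" "M = reorient R N" by (auto simp: reorientation_class_def)
  then show "reorientation_class M = reorientation_class N"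
    using reorientation_class_reorient by simp
next
  assume "reorientation_class M = reorientation_class N"
  then show "M \<in> reorientation_class N" using reorientation_class_self[of M] by simp
qed

lemma f_num_reorient:
  assumes "R \<subseteq> ground M"
  shows "f_num (reorient R M) k = f_num M k"
proof -
  let ?d = "\<lambda>S. S - R \<union> (R - S)"
  have "bij_betw ?d {S. S \<subseteq> ground M \<and> neighborly k (reorient S (reorient R M))}
     {S. S \<subseteq> ground M \<and> neighborly k (reorient S M)}"
  proof (rule bij_betw_byWitness[where f' = ?d])
    show "?d ` {S. S \<subseteq> ground M \<and> neighborly k (reorient S M)} \<subseteq>
       {S. S \<subseteq> ground M \<and> neighborly k (reorient S (reorient R M))}"
    proof safe
      fix S x assume "neighborly k (reorient S M)"
      moreover have "?d (?d S) = S" by blast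
      ultimately show "neighborly k (reorient (?d S) (reorient R M))"
        by (simp add: reorient_reorient)
    qed (use assms in auto)
  qed (use assms in \<open>auto simp: reorient_reorient\<close>)
  then show ?thesis by (simp add: f_num_def bij_betw_same_card)
qed

text \<open>This confines circuits to the band: the element at position \<open>i\<close> has \<open>i\<close> elements to its left
and \<open>length js - Suc i\<close> to its right.\<close>

lemma strict_sorted_nth_bounds:
  assumes "sorted_wrt (<) js" "set js \<subseteq> {1..n}" "i < length js"
  shows "i < js ! i" "js ! i + (length js - Suc i) \<le> n"
proof -
  have gap: "js ! a + (c - a) \<le> js ! c" if "a \<le> c" "c < length js" for a c
    using that
  proof (induction c)
    case (Suc c)
    show ?case
    proof (cases "a = Suc c")
      case False
      then have "js ! a + (c - a) \<le> js ! c" "js ! c < js ! Suc c"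
        using Suc assms(1) sorted_wrt_nth_less by (fastforce)+
      then show ?thesis using Suc.prems False by simp
    qed simp
  qed simp
  have "js ! 0 \<in> {1..n}" "js ! (length js - 1) \<in> {1..n}"
    using assms(2,3) by (metis diff_less less_one nth_mem subsetD neq0_conv not_less0)+
  moreover have "js ! 0 + (i - 0) \<le> js ! i" "js ! i + (length js - 1 - i) \<le> js ! (length js - 1)"
    using assms(3) by (intro gap; simp)+
  ultimately show "i < js ! i" "js ! i + (length js - Suc i) \<le> n" by auto
qed

text \<open>The sign recursion of circuits only involves products of two entries of a row at positions that
can be consecutive in a circuit. Equality of these products up to the signs of the reversed columns is therefore enough. This
allows for negated rows and for arbitrary entries outside the band.\<close>

lemma lawrence_om_eq_reorient:
  assumes A: "sign_matrix r n A" and B: "sign_matrix r n B" and R: "R \<subseteq> {1..n}"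
    and t: "\<And>i j k. i \<in> {1..r} \<Longrightarrow> i \<le> j \<Longrightarrow> j < k \<Longrightarrow> k + r \<le> i + n \<Longrightarrow>
       B i j * B i k = A i j * A i k * (orientation R j * orientation R k)"
  shows "lawrence_om r n B = reorient R (lawrence_om r n A)"
proof -
  have "X \<in> circuits (lawrence_om r n B) \<longleftrightarrow> (\<lambda>e. if e \<in> R then - X e else X e) \<in> circuits (lawrence_om r n A)" for X
  proof -
    define Y where "Y e = orientation R e * X e" for e
    have Y: "(\<lambda>e. if e \<in> R then - X e else X e) = Y" by (auto simp: Y_def orientation_def)
    have supp: "support Y = support X" by (auto simp: support_iff Y_def orientation_def)
    have sv: "Y \<in> sign_vectors {1..n} \<longleftrightarrow> X \<in> sign_vectors {1..n}"
    proof -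
      have "Y e \<in> {-1, 0, 1} \<longleftrightarrow> X e \<in> {-1, 0, 1}" for e by (auto simp: Y_def orientation_def)
      then show ?thesis by (simp add: sign_vectors_def supp)
    qed
    have ch: "chain r A Y js \<longleftrightarrow> chain r B X js" if js: "sorted_wrt (<) js" "set js \<subseteq> {1..n}" "length js = r + 1" for js
    proof -
      have "Y (js ! Suc i) = - Y (js ! i) * A (Suc i) (js ! i) * A (Suc i) (js ! Suc i) \<longleftrightarrow>
        X (js ! Suc i) = - X (js ! i) * B (Suc i) (js ! i) * B (Suc i) (js ! Suc i)" if i: "i < r" for i
      proof -
        let ?j = "js ! i" and ?k = "js ! Suc i"
        have "i < ?j" "?k + (r - Suc i) \<le> n"
          using strict_sorted_nth_bounds[OF js(1,2), of i] strict_sorted_nth_bounds[OF js(1,2), of "Suc i"] js(3) i by auto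
        moreover have "?j < ?k" using js i by (simp add: sorted_wrt_nth_less)
        ultimately have eq: "B (Suc i) ?j * B (Suc i) ?k = A (Suc i) ?j * A (Suc i) ?k * (orientation R ?j * orientation R ?k)"
          using i by (intro t) auto
        have "X ?k = - X ?j * (B (Suc i) ?j * B (Suc i) ?k) \<longleftrightarrow> Y ?k = - Y ?j * (A (Suc i) ?j * A (Suc i) ?k)"
          unfolding eq Y_def orientation_def by auto
        then show ?thesis by (simp only: mult.assoc)
      qed
      then show ?thesis by (auto simp: chain_def)
    qed
    have "chain r A Y (sorted_list_of_set (support X)) \<longleftrightarrow> chain r B X (sorted_list_of_set (support X))"
      if X: "X \<in> sign_vectors {1..n}" "card (support X) = r + 1"
    proof -
      have "finite (support X)" using X(2) card.infinite by fastforce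
      then show ?thesis using X by (intro ch) (auto simp: sign_vectors_def)
    qed
    then show ?thesis unfolding Y lawrence_circuits[OF A] lawrence_circuits[OF B] supp sv by blast
  qed
  then have "circuits (lawrence_om r n B) = circuits (reorient R (lawrence_om r n A))"
    unfolding circuits_reorient by blast
  then show ?thesis by simp
qed

text \<open>Conversely, any two positions \<open>j < k\<close> of row \<open>i\<close> in the band are consecutive in the circuit supported on the first
\<open>i - 1\<close> elements, \<open>j\<close>, \<open>k\<close> and the last \<open>r - i\<close> elements.\<close>

lemma lawrence_om_eq_reorientD:
  assumes A: "sign_matrix r n A" and B: "sign_matrix r n B" and r: "r \<le> n"
    and eq: "lawrence_om r n B = reorient R (lawrence_om r n A)"
    and i: "i \<in> {1..r}" and jk: "i \<le> j" "j < k" "k + r \<le> i + n"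
  shows "B i j * B i k = A i j * A i k * (orientation R j * orientation R k)"
proof -
  define js where "js = [1..<i] @ [j, k] @ [Suc (i + n - r)..<Suc n]"
  have js: "sorted_wrt (<) js" "length js = r + 1" "set js \<subseteq> {1..n}"
    using i jk r by (auto simp: js_def sorted_wrt_append)
  have card: "card (set js) = r + 1"
    using js by (metis distinct_card strict_sorted_iff)
  have sl: "sorted_list_of_set (set js) = js"
    using js(1) by (metis sorted_list_of_set.idem_if_sorted_distinct strict_sorted_iff)
  have nth: "js ! (i - 1) = j" "js ! Suc (i - 1) = k" using i by (auto simp: js_def nth_append)
  have r1: "r \<ge> 1" using i by auto
  obtain Z where Z: "Z \<in> circuits (lawrence_om r n A)" "support Z = set js"
    using circuit_with_support[OF A r1 js(3) card] by blast
  define Y where "Y e = orientation R e * Z e" for e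
  have "(\<lambda>e. if e \<in> R then - Y e else Y e) = Z" by (auto simp: Y_def orientation_def)
  then have Y: "Y \<in> circuits (lawrence_om r n B)" unfolding eq circuits_reorient using Z(1) by simp
  have "support Y = support Z" by (auto simp: support_iff Y_def orientation_def)
  then have chains: "chain r A Z js" "chain r B Y js"
    using Z Y sl by (simp_all add: lawrence_circuits[OF A] lawrence_circuits[OF B])
  have "i - 1 < r" "Suc (i - 1) = i" using i by auto
  then have k: "Z k = - Z j * A i j * A i k" "Y k = - Y j * B i j * B i k"
    using chains nth unfolding chain_def by metis+
  have "j \<in> set js" by (simp add: js_def)
  then have "Z j \<noteq> 0" using Z(2) by (metis support_iff)
  moreover have "orientation R k * (Z j * (A i j * A i k)) = orientation R j * (Z j * (B i j * B i k))"
    using k unfolding Y_def by (simp add: mult.assoc mult.left_commute)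
  then have "Z j * (orientation R k * (A i j * A i k)) = Z j * (orientation R j * (B i j * B i k))"
    by (simp add: mult.left_commute)
  ultimately have "orientation R k * (A i j * A i k) = orientation R j * (B i j * B i k)" by simp
  then show ?thesis by (auto simp: orientation_def)
qed

section \<open>Counting neighborly reorientations\<close>

definition reverse_columns :: "bool list \<Rightarrow> column list \<Rightarrow> column list" where
  "reverse_columns ts xs = map2 (\<lambda>t x. if t then x else map Not x) ts xs"

lemma count_eq_card:
  "count s xs = card {ts. length ts = length xs \<and> alive (foldl step s (reverse_columns ts xs))}"
proof (induction xs arbitrary: s)
  case Nil
  have "{ts :: bool list. ts = [] \<and> alive s} = (if alive s then {[]} else {})" by auto
  then show ?case by (simp add: reverse_columns_def)
next
  case (Cons x xs)
  let ?S = "\<lambda>s. {ts. length ts = length xs \<and> alive (foldl step s (reverse_columns ts xs))}"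
  have fin: "finite (?S s)" for s
    by (rule finite_subset[OF _ finite_lists_length_eq[of UNIV "length xs"]]) auto
  have "{ts. length ts = length (x # xs) \<and> alive (foldl step s (reverse_columns ts (x # xs)))} =
    Cons True ` ?S (step s x) \<union> Cons False ` ?S (step s (map Not x))" (is "?L = ?R")
  proof
    show "?L \<subseteq> ?R"
    proof
      fix ts assume "ts \<in> ?L"
      then obtain t ts' where "ts = t # ts'" "length ts' = length xs"
         "alive (foldl step s (reverse_columns (t # ts') (x # xs)))" by (cases ts) auto
      then show "ts \<in> ?R" by (cases t) (auto simp: reverse_columns_def)
    qed
  qed (auto simp: reverse_columns_def)
  moreover have "card \<dots> = card (Cons True ` ?S (step s x)) + card (Cons False ` ?S (step s (map Not x)))"
    using fin by (intro card_Un_disjoint) auto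
  ultimately show ?case by (simp add: Cons.IH card_image)
qed

text \<open>Reversing \<open>R\<close> negates the columns in \<open>R\<close>, and \<open>count\<close> ranges over all choices of signs for
the columns.\<close>

lemma f_num_eq_count:
  assumes m: "m \<ge> 1" and xs: "length xs = r + m" "\<forall>x\<in>set xs. length x = Suc m"
  shows "f_num (lawrence_om r (r + m) (matrix_of m xs)) 2 = count (initial m) xs"
proof -
  let ?n = "r + m" and ?M = "lawrence_om r (r + m) (matrix_of m xs)"
  define ts where "ts R = map (\<lambda>j. j \<notin> R) [1..<Suc (r + m)]" for R
  have sm: "sign_matrix r ?n (matrix_of m xs)" for xs using matrix_of_sign by (simp add: sign_matrix_def)
  have "neighborly 2 (reorient R ?M) \<longleftrightarrow> alive (foldl step (initial m) (reverse_columns (ts R) xs))"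
    if R: "R \<subseteq> {1..?n}" for R
  proof -
    let ?ys = "reverse_columns (ts R) xs"
    have len: "length ?ys = r + m" using xs(1) by (simp add: reverse_columns_def ts_def del: upt_Suc)
    have nth: "?ys ! l = (if Suc l \<notin> R then xs ! l else map Not (xs ! l))" if "l < r + m" for l
      using that xs(1) by (simp add: reverse_columns_def ts_def del: upt_Suc)
    have "length x = Suc m" if "x \<in> set ?ys" for x
      using that xs(2) by (auto simp: reverse_columns_def set_zip split: if_splits)
    moreover have "lawrence_om r ?n (matrix_of m ?ys) = reorient R ?M"
    proof (rule lawrence_om_eq_reorient[OF sm sm R])
      fix i j k assume "i \<in> {1..r}" "i \<le> j" "j < k" "k + r \<le> i + ?n"
      have "matrix_of m ?ys i j = matrix_of m xs i j * orientation R j" if "i \<in> {1..r}" "i \<le> j" "j \<le> i + m" for j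
      proof -
        have j: "1 \<le> j" "j \<le> r + m" "j - 1 < r + m" using that by auto
        have "length (xs ! (j - 1)) = Suc m" using xs j by simp
        then show ?thesis using that j nth[of "j - 1"] len xs(1) by (simp add: matrix_of_def orientation_def sign_of_def)
      qed
      then show "matrix_of m ?ys i j * matrix_of m ?ys i k = matrix_of m xs i j * matrix_of m xs i k * (orientation R j * orientation R k)"
        using \<open>i \<in> {1..r}\<close> \<open>i \<le> j\<close> \<open>j < k\<close> \<open>k + r \<le> i + ?n\<close> by simp
    qed
    ultimately show ?thesis using neighborly_iff_alive[OF m len] by simp
  qed
  then have "f_num ?M 2 = card {R. R \<subseteq> {1..?n} \<and> alive (foldl step (initial m) (reverse_columns (ts R) xs))}"
    unfolding f_num_def ground_lawrence by (metis (mono_tags, lifting))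
  also have "bij_betw ts {R. R \<subseteq> {1..?n} \<and> alive (foldl step (initial m) (reverse_columns (ts R) xs))}
      {ts. length ts = length xs \<and> alive (foldl step (initial m) (reverse_columns ts xs))}"
  proof (rule bij_betw_byWitness[where f' = "\<lambda>ts. {j \<in> {1..?n}. \<not> ts ! (j - 1)}"])
    have inv: "ts {j \<in> {1..?n}. \<not> us ! (j - 1)} = us" if "length us = ?n" for us
      using that by (intro nth_equalityI) (auto simp: ts_def simp del: upt_Suc)
    show "\<forall>us\<in>{us. length us = length xs \<and> alive (foldl step (initial m) (reverse_columns us xs))}.
        ts {j \<in> {1..?n}. \<not> us ! (j - 1)} = us"
      using inv xs(1) by simp
    show "(\<lambda>us. {j \<in> {1..?n}. \<not> us ! (j - 1)}) `
        {us. length us = length xs \<and> alive (foldl step (initial m) (reverse_columns us xs))}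
      \<subseteq> {R. R \<subseteq> {1..?n} \<and> alive (foldl step (initial m) (reverse_columns (ts R) xs))}"
      using inv xs(1) by auto
    have "ts R ! (j - 1) = (j \<notin> R)" if "j \<in> {1..?n}" for R j
      using that by (auto simp: ts_def simp del: upt_Suc)
    then show "\<forall>R\<in>{R. R \<subseteq> {1..?n} \<and> alive (foldl step (initial m) (reverse_columns (ts R) xs))}.
        {j \<in> {1..?n}. \<not> ts R ! (j - 1)} = R"
      by auto
    show "ts ` {R. R \<subseteq> {1..?n} \<and> alive (foldl step (initial m) (reverse_columns (ts R) xs))}
      \<subseteq> {us. length us = length xs \<and> alive (foldl step (initial m) (reverse_columns us xs))}"
      using xs(1) by (auto simp: ts_def simp del: upt_Suc)
  qed
  then have "card {R. R \<subseteq> {1..?n} \<and> alive (foldl step (initial m) (reverse_columns (ts R) xs))} = count (initial m) xs"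
    unfolding count_eq_card by (rule bij_betw_same_card)
  finally show ?thesis .
qed

section \<open>Normal forms of sign matrices\<close>

text \<open>Entry \<open>k\<close> of column \<open>j\<close> lies in row \<open>j + k - m\<close>. It is fixed if it lies on a boundary diagonal of the band
(\<open>k = 0\<close> or \<open>k = m\<close>), in the first row, or in no row at all.\<close>

definition free_entry :: "nat \<Rightarrow> nat \<Rightarrow> nat \<Rightarrow> nat \<Rightarrow> bool" where
  "free_entry r m j k \<longleftrightarrow> 0 < k \<and> k < m \<and> m + 2 \<le> j + k \<and> j + k \<le> m + r"

definition choices :: "nat \<Rightarrow> nat \<Rightarrow> nat \<Rightarrow> column list" where
  "choices r m j = product_lists
     (map (\<lambda>k. if free_entry r m j k then [True, False] else [True])
       [0..<Suc m])"

definition normal_forms :: "nat \<Rightarrow> nat \<Rightarrow> column list list" where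
  "normal_forms r m = product_lists (map (choices r m) [1..<Suc (r + m)])"

lemma choices_iff:
  "x \<in> set (choices r m j) \<longleftrightarrow> length x = Suc m \<and> (\<forall>k\<le>m. free_entry r m j k \<or> x ! k)"
  unfolding choices_def product_lists_set
  by (auto simp: list_all2_conv_all_nth less_Suc_eq_le simp del: upt_Suc split: if_splits)

lemma distinct_choices: "distinct (choices r m j)"
  unfolding choices_def by (rule distinct_product_lists) auto

lemma normal_forms_iff:
  "xs \<in> set (normal_forms r m) \<longleftrightarrow> length xs = r + m \<and>
     (\<forall>l<r + m. length (xs ! l) = Suc m \<and> (\<forall>k\<le>m. free_entry r m (Suc l) k \<or> xs ! l ! k))"
  unfolding normal_forms_def product_lists_set
  by (simp add: list_all2_conv_all_nth choices_iff del: upt_Suc cong: conj_cong)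

lemma normal_form_shape:
  "xs \<in> set (normal_forms r m) \<Longrightarrow> length xs = r + m \<and> (\<forall>x\<in>set xs. length x = Suc m)"
  unfolding normal_forms_iff by (auto simp: in_set_conv_nth)

lemma matrix_of_normal_form:
  assumes "xs \<in> set (normal_forms r m)" "i \<in> {1..r}" "i \<le> j" "j \<le> i + m" "\<not> free_entry r m j (i + m - j)"
  shows "matrix_of m xs i j = 1"
proof -
  have j: "j - 1 < r + m" "Suc (j - 1) = j" "i + m - j \<le> m" using assms(2-4) by auto
  have "\<forall>k\<le>m. free_entry r m (Suc (j - 1)) k \<or> xs ! (j - 1) ! k"
    using assms(1) j(1) unfolding normal_forms_iff by blast
  then have "xs ! (j - 1) ! (i + m - j)" using j(2,3) assms(5) by auto
  then show ?thesis by (simp add: matrix_of_def sign_of_def)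
qed

text \<open>The sign by which row \<open>i\<close> is to be multiplied. The topmost band entry of column \<open>j\<close>, in row
\<open>max 1 (j - m)\<close>, determines the sign of the column, and the diagonal entry of column \<open>i\<close> then
determines the sign of row \<open>i\<close>.\<close>

fun row_sign :: "nat \<Rightarrow> (nat \<Rightarrow> nat \<Rightarrow> int) \<Rightarrow> nat \<Rightarrow> int" where
  "row_sign m A i = (if i \<le> 1 \<or> m = 0 then 1
     else row_sign m A (max 1 (i - m)) * A (max 1 (i - m)) i * A i i)"

declare row_sign.simps [simp del]

text \<open>The fixed entries form a spanning tree of the bipartite graph of rows and columns whose edges are
the entries of the band. So they can all be made \<open>1\<close>, and the row and column signs which achieve
this are found recursively.\<close>

lemma exists_normal_form:
  assumes m: "m \<ge> 1" and r: "r \<ge> 1" and A: "sign_matrix r (r + m) A"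
  shows "\<exists>xs\<in>set (normal_forms r m). \<exists>R\<subseteq>{1..r + m}.
     lawrence_om r (r + m) (matrix_of m xs) = reorient R (lawrence_om r (r + m) A)"
proof -
  define \<rho> where "\<rho> = row_sign m A"
  define lo where "lo j = max 1 (j - m)" for j
  define \<tau> where "\<tau> j = \<rho> (lo j) * A (lo j) j" for j
  define w where "w i j = \<rho> i * \<tau> j * A i j" for i j
  have A1: "A i j \<in> {1, -1}" if "i \<in> {1..r}" "j \<in> {1..r + m}" for i j
    using A that by (auto simp: sign_matrix_def)
  have lo: "lo j \<in> {1..r}" "j \<noteq> 1 \<longrightarrow> lo j < j" "lo j \<le> j" "j \<le> lo j + m" if "j \<in> {1..r + m}" for j
    using that m r by (auto simp: lo_def max_def)
  have \<rho>1: "\<rho> 1 = 1" by (simp add: \<rho>_def row_sign.simps)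
  have \<rho>: "\<rho> i = \<tau> i * A i i" if "i > 1" for i
    using that m unfolding \<tau>_def \<rho>_def lo_def by (subst row_sign.simps) auto
  have \<rho>s: "\<rho> i \<in> {1, -1}" if "i \<in> {1..r}" for i
    using that
  proof (induction i rule: less_induct)
    case (less i)
    show ?case
    proof (cases "i = 1")
      case False
      then have i: "i > 1" "i \<in> {1..r + m}" using less.prems by auto
      then show ?thesis
        using \<rho>[OF i(1)] less.IH[of "lo i"] lo[OF i(2)] False A1[of "lo i" i] A1[of i i] less.prems
        unfolding \<tau>_def by auto
    qed (use \<rho>1 in simp)
  qed
  have \<tau>s: "\<tau> j \<in> {1, -1}" if "j \<in> {1..r + m}" for j
    using \<rho>s[OF lo(1)[OF that]] A1[OF lo(1)[OF that] that] by (auto simp: \<tau>_def)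
  have ws: "w i j \<in> {1, -1}" if "i \<in> {1..r}" "j \<in> {1..r + m}" for i j
    using \<rho>s[OF that(1)] \<tau>s[OF that(2)] A1[OF that] by (auto simp: w_def)
  have fixed: "w i j = 1" if i: "i \<in> {1..r}" and j: "i \<le> j" "j \<le> i + m" and nf: "\<not> free_entry r m j (i + m - j)" for i j
  proof -
    have jr: "j \<in> {1..r + m}" using i j by auto
    have "lo j = i \<or> j = i \<and> i > 1"
      using i j nf unfolding free_entry_def lo_def by (auto simp: max_def)
    then show ?thesis
    proof
      assume "lo j = i"
      then show ?thesis using \<rho>s[OF i] A1[OF i jr] unfolding w_def \<tau>_def by auto
    next
      assume "j = i \<and> i > 1"
      then show ?thesis using \<rho>[of i] \<tau>s[OF jr] A1[OF i jr] unfolding w_def by auto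
    qed
  qed
  define xs where "xs = map (\<lambda>j. map (\<lambda>k. free_entry r m j k \<longrightarrow> w (j + k - m) j = 1) [0..<Suc m]) [1..<Suc (r + m)]"
  have len: "length xs = r + m" by (simp add: xs_def del: upt_Suc)
  have nth: "xs ! l ! k = (free_entry r m (Suc l) k \<longrightarrow> w (Suc l + k - m) (Suc l) = 1)" "length (xs ! l) = Suc m"
    if "l < r + m" "k \<le> m" for l k
    using that by (simp_all add: xs_def del: upt_Suc)
  have "xs \<in> set (normal_forms r m)"
    unfolding normal_forms_iff using len nth by auto
  moreover define R where "R = {j \<in> {1..r + m}. \<tau> j = -1}"
  have orientation: "orientation R j = \<tau> j" if "j \<in> {1..r + m}" for j
    using that \<tau>s[OF that] by (auto simp: orientation_def R_def)
  have matrix_of: "matrix_of m xs i j = w i j" if i: "i \<in> {1..r}" and j: "i \<le> j" "j \<le> i + m" for i j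
  proof -
    have jr: "j \<in> {1..r + m}" using i j by auto
    have "matrix_of m xs i j = sign_of (xs ! (j - 1) ! (i + m - j))" using i j len by (simp add: matrix_of_def)
    also have "xs ! (j - 1) ! (i + m - j) = (free_entry r m j (i + m - j) \<longrightarrow> w i j = 1)"
      using nth(1)[of "j - 1" "i + m - j"] i j by auto
    finally show ?thesis using fixed[OF i j] ws[OF i jr] by (auto simp: sign_of_def)
  qed
  have "lawrence_om r (r + m) (matrix_of m xs) = reorient R (lawrence_om r (r + m) A)"
  proof (rule lawrence_om_eq_reorient[OF A])
    show "sign_matrix r (r + m) (matrix_of m xs)" using matrix_of_sign by (simp add: sign_matrix_def)
    fix i j k assume ijk: "i \<in> {1..r}" "i \<le> j" "j < k" "k + r \<le> i + (r + m)"
    then have jk: "j \<in> {1..r + m}" "k \<in> {1..r + m}" by auto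
    have "matrix_of m xs i j = w i j" "matrix_of m xs i k = w i k" using ijk by (auto intro: matrix_of)
    then show "matrix_of m xs i j * matrix_of m xs i k = A i j * A i k * (orientation R j * orientation R k)"
      unfolding orientation[OF jk(1)] orientation[OF jk(2)] w_def using \<rho>s[OF ijk(1)] by auto
  qed (auto simp: R_def)
  ultimately show ?thesis by (intro bexI[of _ xs] exI[of _ R]) (auto simp: R_def)
qed

text \<open>The diagonal entry of a row and an entry of this row that is topmost in its column within the band
are both \<open>1\<close> in either normal form, so their two columns are reversed alike. Hence all columns
are, and comparing any entry with the diagonal entry of its row shows that the matrices agree.\<close>

lemma normal_form_unique:
  assumes m: "m \<ge> 1" and xs: "xs \<in> set (normal_forms r m)" and ys: "ys \<in> set (normal_forms r m)"
    and eq: "lawrence_om r (r + m) (matrix_of m ys) = reorient R (lawrence_om r (r + m) (matrix_of m xs))"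
  shows "xs = ys"
proof -
  have sm: "sign_matrix r (r + m) (matrix_of m zs)" for zs using matrix_of_sign by (simp add: sign_matrix_def)
  have D: "matrix_of m ys i j * matrix_of m ys i k = matrix_of m xs i j * matrix_of m xs i k * (orientation R j * orientation R k)"
    if "i \<in> {1..r}" "i \<le> j" "j < k" "k \<le> i + m" for i j k
    using that by (intro lawrence_om_eq_reorientD[OF sm sm _ eq]) auto
  have diag: "matrix_of m zs i i = 1" if "zs \<in> set (normal_forms r m)" "i \<in> {1..r}" for zs i
    using that by (intro matrix_of_normal_form) (auto simp: free_entry_def)
  have orientation: "orientation R j = orientation R 1" if "j \<in> {1..r + m}" "r \<ge> 1" for j
    using that(1)
  proof (induction j rule: less_induct)
    case (less j)
    show ?case
    proof (cases "j = 1")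
      case False
      \<comment> \<open>The row of the topmost band entry of column \<open>j\<close>; its diagonal entry links column \<open>j\<close> to the earlier column \<open>i\<close>.\<close>
      define i where "i = max 1 (j - m)"
      have i: "i \<in> {1..r}" "i < j" "j \<le> i + m" "\<not> free_entry r m j (i + m - j)"
        using less.prems False m that(2) by (auto simp: i_def max_def free_entry_def)
      have "matrix_of m zs i j = 1" if "zs \<in> set (normal_forms r m)" for zs
        using that i by (intro matrix_of_normal_form) auto
      then have "1 = orientation R i * orientation R j"
        using D[of i i j] i diag[of _ i] xs ys by simp
      then have "orientation R j = orientation R i" by (auto simp: orientation_def split: if_splits)
      then show ?thesis using less.IH[of i] i by auto
    qed simp
  qed
  have eq: "matrix_of m ys i j = matrix_of m xs i j" if i: "i \<in> {1..r}" "i < j" "j \<le> i + m" for i j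
  proof -
    have "orientation R i = orientation R 1" "orientation R j = orientation R 1" using i by (intro orientation; simp)+
    then show ?thesis using D[of i i j] i diag[of _ i] xs ys by (auto simp: orientation_def)
  qed
  show ?thesis
  proof (rule nth_equalityI)
    show "length xs = length ys" using xs ys by (simp add: normal_forms_iff)
    fix l assume "l < length xs"
    then have l: "l < r + m" using xs by (simp add: normal_forms_iff)
    then have len: "length (xs ! l) = Suc m" "length (ys ! l) = Suc m"
      using xs ys by (auto simp: normal_forms_iff)
    show "xs ! l = ys ! l"
    proof (rule nth_equalityI)
      fix k assume "k < length (xs ! l)"
      then have k: "k \<le> m" using len by simp
      show "xs ! l ! k = ys ! l ! k"
      proof (cases "free_entry r m (Suc l) k")
        case True
        define i where "i = Suc l + k - m"
        have i: "i \<in> {1..r}" "i < Suc l" "Suc l \<le> i + m" "i + m - Suc l = k"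
          using True by (auto simp: free_entry_def i_def)
        have "matrix_of m zs i (Suc l) = sign_of (zs ! l ! k)" if "zs \<in> set (normal_forms r m)" for zs
          using that i l by (auto simp: matrix_of_def normal_forms_iff)
        then show ?thesis using eq[OF i(1-3)] xs ys by (auto simp: sign_of_def split: if_splits)
      next
        case False
        then show ?thesis using xs ys l k by (auto simp: normal_forms_iff)
      qed
    qed (simp add: len)
  qed
qed

section \<open>Rank seven on eleven elements\<close>

text \<open>The three numbers are evaluated together so that the tables, passed as an argument, are computed once.\<close>

definition report :: "trie list \<Rightarrow> nat \<times> nat \<times> nat" where
  "report ts = (potential 11 (hd ts) (initial 4),
     search (replicate 11 [replicate 5 True]) ts (Some [initial 4]),
     search (map (choices 7 4) [1..<12]) ts (Some [initial 4]))"

lemma product_lists_replicate: "product_lists (replicate n [x]) = [replicate n x]"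
  by (induction n) auto

text \<open>The first number is the upper bound, the second one says that the all-ones matrix attains it, the
third one is the number of normal forms that attain it.\<close>

lemma report: "report (tables 4 11 [initial 4]) = (112, 1, 256)"
  by code_simp

theorem theorem2p25:
  shows "(\<forall>M. is_lawrence_om 7 11 M \<and> M \<notin> reorientation_class (alternating_om 7 11) \<longrightarrow>
              f_num M 2 \<le> c_num 7 11 2) \<and>
         c_num 7 11 2 = 112 \<and>
         card {reorientation_class M |M. is_lawrence_om 7 11 M \<and>
              M \<notin> reorientation_class (alternating_om 7 11) \<and>
              f_num M 2 = c_num 7 11 2} = 255"
proof -
  let ?N = "set (normal_forms 7 4)"
  define F where "F xs = lawrence_om 7 11 (matrix_of 4 xs)" for xs
  define ts where "ts = tables 4 11 [initial 4]"
  have ts: "superharmonic 4 ts" "length ts = 12"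
    using superharmonic_tables[of 4 11 "[initial 4]"] by (simp_all add: ts_def)
  note rep = report[folded ts_def, unfolded report_def prod.inject]
  have top: "potential 11 (hd ts) (initial 4) = 112" using rep by simp
  have init: "length (initial 4) = 4" by (simp add: initial_def)
  have wf: "length xs = 7 + 4" "\<forall>x\<in>set xs. length x = Suc 4" if "xs \<in> ?N" for xs
    using normal_form_shape[OF that] by auto
  have le: "count (initial 4) xs \<le> 112" if "xs \<in> ?N" for xs
    using count_le_potential[OF ts(1) _ init wf(2)[OF that]] wf(1)[OF that] ts(2) top by simp
  have card256: "card {xs \<in> ?N. count (initial 4) xs = 112} = 256"
    using search_eq_card[OF ts(1), of "map (choices 7 4) [1..<12]" "[initial 4]"] ts(2) init rep top
    by (simp add: normal_forms_def distinct_choices choices_iff del: upt_Suc)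
  define a where "a = replicate 11 (replicate 5 True)"
  have a: "a \<in> ?N" unfolding normal_forms_iff a_def by (simp add: nth_append)
  have ca: "count (initial 4) a = 112"
  proof -
    have "card {xs \<in> set (product_lists (replicate 11 [replicate 5 True])). count (initial 4) xs = 112} = 1"
      using search_eq_card[OF ts(1), of "replicate 11 [replicate 5 True]" "[initial 4]"] ts(2) init rep top
      by simp
    then have "card {xs \<in> {a}. count (initial 4) xs = 112} = 1"
      unfolding product_lists_replicate a_def by simp
    then have "{xs \<in> {a}. count (initial 4) xs = 112} \<noteq> {}" by (metis card.empty zero_neq_one)
    then show ?thesis by blast
  qed
  have alt: "alternating_om 7 11 = F a"
  proof -
    have "matrix_of 4 a = (\<lambda>_ _. 1)" by (auto simp: fun_eq_iff matrix_of_def a_def sign_of_def)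
    then show ?thesis by (simp add: alternating_om_eq_lawrence F_def)
  qed
  have f: "f_num (F xs) 2 = count (initial 4) xs" if "xs \<in> ?N" for xs
    using f_num_eq_count[OF _ wf[OF that]] by (simp add: F_def)
  have c: "c_num 7 11 2 = 112" using f[OF a] ca alt by (simp add: c_num_def)
  \<comment> \<open>Classes and normal forms correspond to each other, existence first, then uniqueness.\<close>
  have nf: "\<exists>xs\<in>?N. reorientation_class M = reorientation_class (F xs) \<and> f_num M 2 = count (initial 4) xs"
    if "is_lawrence_om 7 11 M" for M
  proof -
    obtain A where A: "sign_matrix 7 11 A" "M = lawrence_om 7 11 A"
      using \<open>is_lawrence_om 7 11 M\<close> by (auto simp: is_lawrence_om_def)
    then obtain xs R where xs: "xs \<in> ?N" "R \<subseteq> {1..11}" "F xs = reorient R M"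
      using exists_normal_form[of 4 7 A] by (auto simp: F_def)
    then show ?thesis
      using reorientation_class_reorient[of R M] f_num_reorient[of R M 2] A(2) f[OF xs(1)]
      by (intro bexI[of _ xs]) auto
  qed
  have inj: "xs = ys" if "xs \<in> ?N" "ys \<in> ?N" "reorientation_class (F xs) = reorientation_class (F ys)" for xs ys
  proof -
    have "F ys \<in> reorientation_class (F xs)" using that(3) mem_reorientation_class_iff by metis
    then obtain R where "F ys = reorient R (F xs)" by (auto simp: reorientation_class_def)
    then show ?thesis using normal_form_unique[OF _ that(1,2), of R] by (simp add: F_def)
  qed
  have lom: "is_lawrence_om 7 11 (F xs)" for xs
  proof -
    have "sign_matrix 7 11 (matrix_of 4 xs)" using matrix_of_sign by (simp add: sign_matrix_def)
    then show ?thesis unfolding is_lawrence_om_def F_def by (intro conjI exI[of _ "matrix_of 4 xs"]) auto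
  qed
  have "{reorientation_class M |M. is_lawrence_om 7 11 M \<and>
      M \<notin> reorientation_class (alternating_om 7 11) \<and> f_num M 2 = c_num 7 11 2} =
    (\<lambda>xs. reorientation_class (F xs)) ` ({xs \<in> ?N. count (initial 4) xs = 112} - {a})" (is "?L = ?R")
  proof
    show "?L \<subseteq> ?R"
    proof
      fix C assume "C \<in> ?L"
      then obtain M where M: "C = reorientation_class M" "is_lawrence_om 7 11 M"
        "reorientation_class M \<noteq> reorientation_class (F a)" "f_num M 2 = 112"
        unfolding c alt mem_reorientation_class_iff by blast
      then show "C \<in> ?R" using nf[OF M(2)] by auto
    qed
    show "?R \<subseteq> ?L"
    proof
      fix C assume "C \<in> ?R"
      then obtain xs where xs: "xs \<in> ?N" "count (initial 4) xs = 112" "xs \<noteq> a" "C = reorientation_class (F xs)"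
        by blast
      then have "F xs \<notin> reorientation_class (F a)" using inj[OF xs(1) a] mem_reorientation_class_iff by metis
      then show "C \<in> ?L" unfolding c alt using xs lom f[OF xs(1)] by auto
    qed
  qed
  moreover have "card ((\<lambda>xs. reorientation_class (F xs)) ` ({xs \<in> ?N. count (initial 4) xs = 112} - {a})) = 255"
    using card256 a ca inj by (subst card_image) (auto simp: inj_on_def)
  moreover have "f_num M 2 \<le> 112" if "is_lawrence_om 7 11 M" for M
    using nf[OF that] le by auto
  ultimately show ?thesis using c by simp
qed

end
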